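(* Let $\beta>1$ and let $k_c(\beta)$ be as defined in the context. Then \[ \varPhi_\beta(x,y)=M+\bigl(l(2k_c(\beta),\beta)+\sqrt2-1\bigr)m,\qquad M=\max\{|x|,|y|\},\ m=\min\{|x|,|y|\}, \] for every $(x,y)\in\mathbb{R}^2$ belonging to one of the cones $\{(2k_c(\beta)+1)|y|\le|x|\}$ or $\{(2k_c(\beta)+1)|x|\le|y|\}$.
   Context: Chessboard structure: for $\beta>1$ let $a_\beta:\mathbb{R}^2\to\{1,\beta\}$ be $2$-periodic in each variable with, on $[0,2)\times[0,2)$, $a_\beta=\beta$ on $((0,1)\times(1,2))\cup((1,2)\times(0,1))$ and $a_\beta=1$ otherwise. For $\varepsilon>0$ let $d^\varepsilon_\beta(0,\xi)=\inf\{\int_0^1 a_\beta(u(t)/\varepsilon)|u'(t)|\,dt:\ u\in AC([0,1];\mathbb{R}^2),\ u(0)=0,\ u(1)=\xi\}$, and $\varPhi_\beta(\xi)=\lim_{\varepsilon\to0^+}d^\varepsilon_\beta(0,\xi)$ (the limit exists). Normalized length: for $t\ge 0$ let $q(t)=\lfloor t+1\rfloor/2$ if $\lfloor t\rfloor$ is odd and $q(t)=t-\lfloor t\rfloor/2$ if $\lfloor t\rfloor$ is even, $p(t)=t+1-q(t)$; let $\hat\sigma(t,\beta)\in(0,1)$ be the unique solution $\sigma$ of $\frac{p(t)\sigma}{\sqrt{1-\sigma^2}}+\frac{q(t)\sigma}{\sqrt{\beta^2-\sigma^2}}=1$, and $l(t,\beta)=\frac{p(t)}{\sqrt{1-\hat\sigma^2}}+\frac{\beta^2q(t)}{\sqrt{\beta^2-\hat\sigma^2}}-t-\sqrt2$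 with $\hat\sigma=\hat\sigma(t,\beta)$. With $\mathbb{N}=\{0,1,2,\dots\}$, let $\delta(k,\beta)=l(2k+2,\beta)-l(2k,\beta)$ for $k\in\mathbb{N}$ and $k_c(\beta)=\min\{k\in\mathbb{N}:\ \delta(k,\beta)>0\}$. *)

theory Defs
  imports "HOL-Analysis.Analysis"
begin

definition mod2r :: "real \<Rightarrow> real" where
  "mod2r x = x - 2 * of_int \<lfloor>x / 2\<rfloor>"

definition a_beta :: "real \<Rightarrow> real \<times> real \<Rightarrow> real" where
  "a_beta \<beta> z = (let s = mod2r (fst z); t = mod2r (snd z) in
     if (0 < s \<and> s < 1 \<and> 1 < t \<and> t < 2) \<or> (1 < s \<and> s < 2 \<and> 0 < t \<and> t < 1)
     then \<beta> else 1)"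

definition abs_cont_on :: "real \<Rightarrow> real \<Rightarrow> (real \<Rightarrow> 'a::real_normed_vector) \<Rightarrow> bool" where
  "abs_cont_on a b f \<longleftrightarrow>
     (\<forall>e>0. \<exists>d>0. \<forall>n (l::nat \<Rightarrow> real) r.
        (\<forall>i<n. a \<le> l i \<and> l i < r i \<and> r i \<le> b) \<and>
        (\<forall>i<n. \<forall>j<n. i \<noteq> j \<longrightarrow> r i \<le> l j \<or> r j \<le> l i) \<and>
        (\<Sum>i<n. r i - l i) < d
        \<longrightarrow> (\<Sum>i<n. norm (f (r i) - f (l i))) < e)"

definition wlength :: "real \<Rightarrow> real \<Rightarrow> (real \<Rightarrow> real \<times> real) \<Rightarrow> real" where
  "wlength \<beta> \<epsilon> u =
     integral {0..1} (\<lambda>t. a_beta \<beta> ((1 / \<epsilon>) *\<^sub>R u t) * norm (vector_derivative u (at t)))"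

definition d_eps :: "real \<Rightarrow> real \<Rightarrow> real \<times> real \<Rightarrow> real" where
  "d_eps \<beta> \<epsilon> \<xi> = Inf {wlength \<beta> \<epsilon> u | u. abs_cont_on 0 1 u \<and> u 0 = (0, 0) \<and> u 1 = \<xi>}"

definition Phi :: "real \<Rightarrow> real \<times> real \<Rightarrow> real" where
  "Phi \<beta> \<xi> = Lim (at_right 0) (\<lambda>\<epsilon>. d_eps \<beta> \<epsilon> \<xi>)"

definition qf :: "real \<Rightarrow> real" where
  "qf t = (if odd \<lfloor>t\<rfloor> then of_int \<lfloor>t + 1\<rfloor> / 2 else t - of_int \<lfloor>t\<rfloor> / 2)"

definition pf :: "real \<Rightarrow> real" where
  "pf t = t + 1 - qf t"

definition sigma_hat :: "real \<Rightarrow> real \<Rightarrow> real" where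
  "sigma_hat t \<beta> = (THE \<sigma>. 0 < \<sigma> \<and> \<sigma> < 1 \<and>
      pf t * \<sigma> / sqrt (1 - \<sigma>\<^sup>2) + qf t * \<sigma> / sqrt (\<beta>\<^sup>2 - \<sigma>\<^sup>2) = 1)"

definition lf :: "real \<Rightarrow> real \<Rightarrow> real" where
  "lf t \<beta> = (let \<sigma> = sigma_hat t \<beta> in
      pf t / sqrt (1 - \<sigma>\<^sup>2) + \<beta>\<^sup>2 * qf t / sqrt (\<beta>\<^sup>2 - \<sigma>\<^sup>2) - t - sqrt 2)"

definition delta :: "nat \<Rightarrow> real \<Rightarrow> real" where
  "delta k \<beta> = lf (2 * real k + 2) \<beta> - lf (2 * real k) \<beta>"

definition k_c :: "real \<Rightarrow> nat" where
  "k_c \<beta> = (LEAST k. delta k \<beta> > 0)"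

end

theory Submission
  imports Defs
begin

text \<open>
  Put \<open>L = l(2k\<^sub>c) + sqrt 2 - 1\<close>. By Snell's law \<open>l(2k) + sqrt 2 - 1\<close> is the maximum over sines
  \<open>\<sigma>\<close> of a function affine in \<open>k\<close>, so it is convex in \<open>k\<close> and \<open>k\<^sub>c\<close> is a global minimizer.

  Upper bound: at scale 1, climb each unit strip along the refracted path crossing \<open>k\<^sub>c + 1\<close> light and
  \<open>k\<^sub>c\<close> dark cells; parity makes the next strip start again at a light cell. The remaining
  displacement is horizontal along a grid line, at unit cost.

  Lower bound: cut a curve at successive crossings of the horizontal strips. Outside the crossings the cost
  is at least the horizontal displacement. A crossing that covers length \<open>p\<close> of light and \<open>q\<close> of
  dark columns costs at least \<open>p sqrt(1 - \<sigma>\<^sup>2) + q sqrt(\<beta>\<^sup>2 - \<sigma>\<^sup>2) + \<sigma>\<close> for every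
  \<open>\<sigma>\<close> in \<open>[0,1]\<close>, and \<open>p \<le> \<lfloor>q\<rfloor> + 1\<close>; a suitable \<open>\<sigma>\<close> makes this at least
  \<open>p + q + L\<close>. Both bounds differ from the claimed value by \<open>O(\<epsilon>)\<close>.

  Integrability of the length integrand needs that absolutely continuous functions are a.e. differentiable and
  integrals of their derivative. This is obtained from the Radon-Nikodym theorem applied to the Stieltjes measures of
  the variation function and of its sum with the function.
\<close>

section \<open>Absolutely continuous functions\<close>

text \<open>The delicate crossings of the lower bound end inside a dark column: the light width is
  still at most k + 1 while the dark width q may be anything between k and k + 1, so minimality of
  the excess over integers does not decide. The bound is affine in q with slope
  \<open>sqrt (\<beta>\<^sup>2 - \<sigma>\<^sup>2) - 1\<close>. If this slope is negative at the
  optimal sine for k but positive at the one for k + 1, the sine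
  \<open>sqrt (\<beta>\<^sup>2 - 1)\<close> removes q from the bound, and what is left is an
  explicit inequality, nearly sharp for k = 0.

  The cone enters through the upper bound: a refracted climb of height b takes about (2 k + 1) b of
  horizontal room, and the cone for k = \<open>k_c\<close> provides it.

  Integrability matters because \<open>integral\<close> is 0 for a function that is not integrable:
  a single admissible curve with such an integrand would have length 0 and ruin the infimum.\<close>

definition disjoint_ivls :: "nat set \<Rightarrow> (nat \<Rightarrow> real) \<Rightarrow> (nat \<Rightarrow> real) \<Rightarrow> bool" where
  "disjoint_ivls I l r \<longleftrightarrow> finite I \<and> (\<forall>i\<in>I. l i \<le> r i) \<and>
     (\<forall>i\<in>I. \<forall>j\<in>I. i \<noteq> j \<longrightarrow> r i \<le> l j \<or> r j \<le> l i)"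

lemma disjoint_ivlsI:
  assumes "finite I" "\<And>i. i \<in> I \<Longrightarrow> l i \<le> r i"
    "\<And>i j. \<lbrakk>i \<in> I; j \<in> I; i \<noteq> j\<rbrakk> \<Longrightarrow> r i \<le> l j \<or> r j \<le> l i"
  shows "disjoint_ivls I l r"
  unfolding disjoint_ivls_def by (intro conjI ballI impI assms)

lemma disjoint_ivlsD:
  assumes "disjoint_ivls I l r"
  shows "finite I" "i \<in> I \<Longrightarrow> l i \<le> r i" "\<lbrakk>i \<in> I; j \<in> I; i \<noteq> j\<rbrakk> \<Longrightarrow> r i \<le> l j \<or> r j \<le> l i"
  using assms by (simp_all add: disjoint_ivls_def)

text \<open>Unlike in \<open>abs_cont_on\<close>, index sets are arbitrary finite sets and intervals
  may be degenerate, so subfamilies and unions of cells need no renumbering.\<close>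

definition ac_modulus :: "(real \<Rightarrow> 'a::real_normed_vector) \<Rightarrow> real \<Rightarrow> real \<Rightarrow> bool" where
  "ac_modulus f e d \<longleftrightarrow> (\<forall>I l r. disjoint_ivls I l r \<longrightarrow> (\<Sum>i\<in>I. r i - l i) < d
     \<longrightarrow> (\<Sum>i\<in>I. norm (f (r i) - f (l i))) < e)"

lemma ac_modulusD:
  "\<lbrakk>ac_modulus f e d; disjoint_ivls I l r; (\<Sum>i\<in>I. r i - l i) < d\<rbrakk>
    \<Longrightarrow> (\<Sum>i\<in>I. norm (f (r i) - f (l i))) < e"
  by (simp add: ac_modulus_def)

definition acont :: "(real \<Rightarrow> 'a::real_normed_vector) \<Rightarrow> bool" where
  "acont f \<longleftrightarrow> (\<forall>e>0. \<exists>d>0. ac_modulus f e d)"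

lemma acontE:
  assumes "acont f" "e > 0"
  obtains d where "d > 0" "ac_modulus f e d"
  using assms unfolding acont_def by blast

lemma acontI:
  assumes "\<And>e. e > 0 \<Longrightarrow> \<exists>d>0. \<forall>I l r. disjoint_ivls I l r \<longrightarrow> (\<Sum>i\<in>I. r i - l i) < d
     \<longrightarrow> (\<Sum>i\<in>I. norm (f (r i) - f (l i))) < e"
  shows "acont f"
  using assms unfolding acont_def ac_modulus_def by blast

text \<open>Clamping the time gives a function on the whole line, constant off the unit interval, so
  that nothing below carries a domain. The clamp is monotone and 1-Lipschitz: it keeps intervals
  apart and does not lengthen them.\<close>

lemma abs_cont_on_imp_acont_clamp:
  assumes "abs_cont_on 0 1 f"
  shows "acont (\<lambda>t. f (max 0 (min 1 t)))"
proof (rule acontI)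
  fix e :: real assume "e > 0"
  then have "\<exists>d>0. \<forall>n (l::nat \<Rightarrow> real) r.
        (\<forall>i<n. 0 \<le> l i \<and> l i < r i \<and> r i \<le> 1) \<and>
        (\<forall>i<n. \<forall>j<n. i \<noteq> j \<longrightarrow> r i \<le> l j \<or> r j \<le> l i) \<and>
        (\<Sum>i<n. r i - l i) < d
        \<longrightarrow> (\<Sum>i<n. norm (f (r i) - f (l i))) < e"
    by (rule assms[unfolded abs_cont_on_def, rule_format])
  then obtain d where "d > 0" and d: "\<forall>n (l::nat \<Rightarrow> real) r.
        (\<forall>i<n. 0 \<le> l i \<and> l i < r i \<and> r i \<le> 1) \<and>
        (\<forall>i<n. \<forall>j<n. i \<noteq> j \<longrightarrow> r i \<le> l j \<or> r j \<le> l i) \<and>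
        (\<Sum>i<n. r i - l i) < d
        \<longrightarrow> (\<Sum>i<n. norm (f (r i) - f (l i))) < e" by (elim exE conjE)
  define cl :: "real \<Rightarrow> real" where "cl = (\<lambda>t. max 0 (min 1 t))"
  have cl_mono: "cl x \<le> cl y" if "x \<le> y" for x y using that by (auto simp: cl_def)
  have cl_lip: "cl y - cl x \<le> y - x" if "x \<le> y" for x y using that by (auto simp: cl_def)
  show "\<exists>d>0. \<forall>I l r. disjoint_ivls I l r \<longrightarrow> (\<Sum>i\<in>I. r i - l i) < d
     \<longrightarrow> (\<Sum>i\<in>I. norm (f (max 0 (min 1 (r i))) - f (max 0 (min 1 (l i))))) < e"
  proof (intro exI[of _ d] conjI allI impI \<open>d > 0\<close>)
    fix I :: "nat set" and l r :: "nat \<Rightarrow> real"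
    assume dis: "disjoint_ivls I l r" and len: "(\<Sum>i\<in>I. r i - l i) < d"
    note I = disjoint_ivlsD(1)[OF dis] and lr = disjoint_ivlsD(2)[OF dis] and disj = disjoint_ivlsD(3)[OF dis]
    \<comment> \<open>Intervals collapsed by the clamp are dropped: \<open>abs_cont_on\<close>
      admits only \<open>l i < r i\<close>, and they contribute 0.\<close>
    define J where "J = {i\<in>I. cl (l i) < cl (r i)}"
    have J: "finite J" "J \<subseteq> I" using I by (auto simp: J_def)
    obtain h where h: "bij_betw h {..<card J} J"
      using ex_bij_betw_nat_finite[OF J(1)] by (auto simp: atLeast0LessThan)
    have hJ: "h i \<in> J" if "i < card J" for i using h that by (auto simp: bij_betw_def)
    have inj: "h i \<noteq> h j" if "i < card J" "j < card J" "i \<noteq> j" for i j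
      using h that by (auto simp: bij_betw_def inj_on_def)
    have "(\<Sum>i<card J. cl (r (h i)) - cl (l (h i))) = (\<Sum>i\<in>J. cl (r i) - cl (l i))"
      by (rule sum.reindex_bij_betw[OF h])
    also have "\<dots> \<le> (\<Sum>i\<in>J. r i - l i)" using J lr by (intro sum_mono cl_lip) auto
    also have "\<dots> \<le> (\<Sum>i\<in>I. r i - l i)" using I J lr by (intro sum_mono2) auto
    finally have len': "(\<Sum>i<card J. cl (r (h i)) - cl (l (h i))) < d" using len by simp
    have "(\<Sum>i<card J. norm (f (cl (r (h i))) - f (cl (l (h i))))) < e"
    proof (rule d[rule_format], intro conjI allI impI)
      fix i j assume "i < card J" "j < card J" "i \<noteq> j"
      then have "r (h i) \<le> l (h j) \<or> r (h j) \<le> l (h i)" using disj[OF _ _ inj] hJ J by (meson subsetD)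
      then show "cl (r (h i)) \<le> cl (l (h j)) \<or> cl (r (h j)) \<le> cl (l (h i))" using cl_mono by blast
    next
      fix i assume "i < card J"
      then have "h i \<in> J" by (rule hJ)
      then show "cl (l (h i)) < cl (r (h i))" by (simp add: J_def)
    next
      show "0 \<le> cl (l (h i))" "cl (r (h i)) \<le> 1" for i by (auto simp: cl_def)
    qed (rule len')
    also have "(\<Sum>i<card J. norm (f (cl (r (h i))) - f (cl (l (h i))))) = (\<Sum>i\<in>J. norm (f (cl (r i)) - f (cl (l i))))"
      by (rule sum.reindex_bij_betw[OF h])
    also have "\<dots> = (\<Sum>i\<in>I. norm (f (cl (r i)) - f (cl (l i))))"
    proof (rule sum.mono_neutral_left[OF I J(2)], rule ballI)
      fix i assume "i \<in> I - J"
      then have "cl (l i) = cl (r i)" using lr cl_mono by (force simp: J_def)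
      then show "norm (f (cl (r i)) - f (cl (l i))) = 0" by simp
    qed
    finally show "(\<Sum>i\<in>I. norm (f (max 0 (min 1 (r i))) - f (max 0 (min 1 (l i))))) < e"
      by (simp add: cl_def)
  qed
qed

lemma acont_le_add:
  assumes f: "acont f" and g: "acont g"
    and "\<And>s t. s \<le> t \<Longrightarrow> norm (h t - h s) \<le> norm (f t - f s) + norm (g t - g s)"
  shows "acont h"
proof (rule acontI)
  fix e :: real assume "e > 0"
  then have e2: "e / 2 > 0" by simp
  obtain d1 where d1: "d1 > 0" "ac_modulus f (e / 2) d1"
    by (rule acontE[OF f e2])
  obtain d2 where d2: "d2 > 0" "ac_modulus g (e / 2) d2"
    by (rule acontE[OF g e2])
  show "\<exists>d>0. \<forall>I l r. disjoint_ivls I l r \<longrightarrow> (\<Sum>i\<in>I. r i - l i) < d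
     \<longrightarrow> (\<Sum>i\<in>I. norm (h (r i) - h (l i))) < e"
  proof (intro exI[of _ "min d1 d2"] conjI allI impI)
    fix I :: "nat set" and l r :: "nat \<Rightarrow> real"
    assume dis: "disjoint_ivls I l r" and len: "(\<Sum>i\<in>I. r i - l i) < min d1 d2"
    have "(\<Sum>i\<in>I. norm (h (r i) - h (l i))) \<le> (\<Sum>i\<in>I. norm (f (r i) - f (l i)) + norm (g (r i) - g (l i)))"
      by (intro sum_mono assms(3) disjoint_ivlsD(2)[OF dis])
    also have "\<dots> = (\<Sum>i\<in>I. norm (f (r i) - f (l i))) + (\<Sum>i\<in>I. norm (g (r i) - g (l i)))"
      by (rule sum.distrib)
    also have "\<dots> < e / 2 + e / 2"
      using len by (intro add_strict_mono ac_modulusD[OF d1(2)] ac_modulusD[OF d2(2)] dis) auto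
    finally show "(\<Sum>i\<in>I. norm (h (r i) - h (l i))) < e" by simp
  qed (use d1 d2 in auto)
qed

lemma acont_dominated:
  assumes f: "acont f" and "\<And>s t. s \<le> t \<Longrightarrow> norm (h t - h s) \<le> norm (f t - f s)"
  shows "acont h"
proof (rule acont_le_add[OF f f])
  fix s t :: real assume "s \<le> t"
  then show "norm (h t - h s) \<le> norm (f t - f s) + norm (f t - f s)"
    using assms(2)[of s t] norm_ge_zero[of "f t - f s"] by linarith
qed

lemma acont_continuous:
  assumes "acont f" shows "continuous_on UNIV f"
proof -
  have "\<exists>d>0. \<forall>x'. dist x' x < d \<longrightarrow> dist (f x') (f x) < e" if "e > 0" for x e
  proof -
    obtain d where d: "d > 0" "ac_modulus f (e) d"
      by (rule acontE[OF assms \<open>e > 0\<close>])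
    show ?thesis
    proof (intro exI[of _ d] conjI d(1) allI impI)
      fix y assume "dist y x < d"
      then have "norm (f (max x y) - f (min x y)) < e"
        using ac_modulusD[OF d(2), of "{0}" "\<lambda>_. min x y" "\<lambda>_. max x y"] by (auto simp: dist_real_def disjoint_ivls_def)
      then show "dist (f y) (f x) < e"
        by (auto simp: dist_norm max_def min_def norm_minus_commute split: if_splits)
    qed
  qed
  then show ?thesis by (auto simp: continuous_on_iff)
qed

section \<open>Variation of an absolutely continuous function\<close>

definition dyadic_var :: "(real \<Rightarrow> real) \<Rightarrow> nat \<Rightarrow> real \<Rightarrow> real" where
  "dyadic_var f n t = (\<Sum>j<nat \<lfloor>2^n * t\<rfloor>. \<bar>f (real (Suc j) / 2^n) - f (real j / 2^n)\<bar>)"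

lemma dyadic_var_diff:
  assumes "s \<le> t"
  shows "dyadic_var f n t - dyadic_var f n s
    = (\<Sum>j\<in>{nat \<lfloor>2^n * s\<rfloor>..<nat \<lfloor>2^n * t\<rfloor>}. \<bar>f (real (Suc j) / 2^n) - f (real j / 2^n)\<bar>)"
proof -
  have le: "nat \<lfloor>2^n * s\<rfloor> \<le> nat \<lfloor>2^n * t\<rfloor>"
    using assms by (intro nat_mono floor_mono mult_left_mono) auto
  then show ?thesis unfolding dyadic_var_def
    by (subst sum_diff_nat_ivl[of 0 _ _, simplified atLeast0LessThan, symmetric]) auto
qed

lemma dyadic_var_mono: "s \<le> t \<Longrightarrow> dyadic_var f n s \<le> dyadic_var f n t"
  using dyadic_var_diff[of s t f n]
  by (metis (no_types, lifting) abs_ge_zero diff_ge_0_iff_ge sum_nonneg)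

lemma sum_lessThan_double:
  fixes g :: "nat \<Rightarrow> real"
  shows "(\<Sum>j<2*m. g j) = (\<Sum>j<m. g (2*j) + g (Suc (2*j)))"
  by (induction m) auto

lemma dyadic_var_Suc: "dyadic_var f n t \<le> dyadic_var f (Suc n) t"
proof -
  let ?c = "\<lambda>n j. \<bar>f (real (Suc j) / 2^n) - f (real j / 2^n)\<bar>"
  let ?m = "nat \<lfloor>2^n * t\<rfloor>"
  have le: "2 * ?m \<le> nat \<lfloor>2^Suc n * t\<rfloor>"
  proof -
    have "2 * \<lfloor>2^n * t\<rfloor> \<le> \<lfloor>2^Suc n * t\<rfloor>"
      by (simp add: le_floor_iff mult.assoc)
    then show ?thesis by linarith
  qed
  have "dyadic_var f n t \<le> (\<Sum>j<?m. ?c (Suc n) (2*j) + ?c (Suc n) (Suc (2*j)))"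
    unfolding dyadic_var_def
  proof (rule sum_mono)
    fix j
    have "real (Suc j) / 2^n = real (Suc (Suc (2*j))) / 2^Suc n" "real j / 2^n = real (2*j) / 2^Suc n"
      by (simp_all add: field_simps)
    then show "?c n j \<le> ?c (Suc n) (2*j) + ?c (Suc n) (Suc (2*j))" by simp
  qed
  also have "\<dots> = (\<Sum>j<2*?m. ?c (Suc n) j)" by (rule sum_lessThan_double[symmetric])
  also have "\<dots> \<le> dyadic_var f (Suc n) t"
    unfolding dyadic_var_def using le by (intro sum_mono2) auto
  finally show ?thesis .
qed

text \<open>The cells counted have their right end point in the interval from s to t. The first one
  may start before s, hence the extra mesh width.\<close>

lemma dyadic_cells_length:
  assumes "s \<le> t"
  shows "real (nat \<lfloor>2^n * t\<rfloor> - nat \<lfloor>2^n * s\<rfloor>) / 2^n \<le> t - s + 1/2^n"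
proof (cases "t < 0")
  case True
  then have "2^n * t \<le> 0" by (simp add: mult_nonneg_nonpos)
  then have "nat \<lfloor>2^n * t\<rfloor> = 0" by simp
  then show ?thesis using assms by simp
next
  case False
  then have "2^n * t \<ge> 0" by simp
  then have 1: "real (nat \<lfloor>2^n * t\<rfloor>) \<le> 2^n * t" by linarith
  have 2: "real (nat \<lfloor>2^n * s\<rfloor>) \<ge> 2^n * s - 1" by linarith
  have le: "nat \<lfloor>2^n * s\<rfloor> \<le> nat \<lfloor>2^n * t\<rfloor>"
    using assms by (intro nat_mono floor_mono mult_left_mono) auto
  have "real (nat \<lfloor>2^n * t\<rfloor> - nat \<lfloor>2^n * s\<rfloor>) \<le> 2^n * (t - s) + 1"
    using 1 2 le by (simp add: of_nat_diff algebra_simps)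
  then have "real (nat \<lfloor>2^n * t\<rfloor> - nat \<lfloor>2^n * s\<rfloor>) / 2^n \<le> (2^n * (t - s) + 1) / 2^n"
    by (intro divide_right_mono) auto
  then show ?thesis by (simp add: add_divide_distrib)
qed

text \<open>Cells with right end point in one of the disjoint intervals have little more total length than
  the intervals, so absolute continuity of \<open>f\<close> passes to its dyadic variations uniformly in the level.\<close>

lemma dyadic_var_family:
  assumes d: "ac_modulus f (e) d"
    and dis: "disjoint_ivls I l r" and len: "(\<Sum>i\<in>I. r i - l i) + real (card I) / 2^n < d"
  shows "(\<Sum>i\<in>I. dyadic_var f n (r i) - dyadic_var f n (l i)) < e"
proof -
  note I = disjoint_ivlsD[OF dis]
  define m where "m = (\<lambda>t::real. nat \<lfloor>2^n * t\<rfloor>)"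
  have m_mono: "m s \<le> m t" if "s \<le> t" for s t
    unfolding m_def using that by (intro nat_mono floor_mono mult_left_mono) auto
  define A where "A = (\<lambda>i. {m (l i)..<m (r i)})"
  have dj: "\<forall>i\<in>I. \<forall>j\<in>I. i \<noteq> j \<longrightarrow> A i \<inter> A j = {}"
  proof (intro ballI impI)
    fix i j assume "i \<in> I" "j \<in> I" "i \<noteq> j"
    then have "m (r i) \<le> m (l j) \<or> m (r j) \<le> m (l i)" using I(3) m_mono by meson
    then show "A i \<inter> A j = {}" by (auto simp: A_def)
  qed
  let ?J = "\<Union>i\<in>I. A i"
  have fin: "\<forall>i\<in>I. finite (A i)" by (simp add: A_def)
  have cell: "real (Suc j) / 2^n - real j / 2^n = 1 / 2^n" for j
    by (simp add: field_simps)
  have "(\<Sum>i\<in>I. dyadic_var f n (r i) - dyadic_var f n (l i))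
      = (\<Sum>i\<in>I. \<Sum>j\<in>A i. \<bar>f (real (Suc j) / 2^n) - f (real j / 2^n)\<bar>)"
    using I(2) by (intro sum.cong refl) (simp add: dyadic_var_diff A_def m_def)
  also have "\<dots> = (\<Sum>j\<in>?J. norm (f (real (Suc j) / 2^n) - f (real j / 2^n)))"
    using sum.UNION_disjoint[OF I(1) fin dj, of "\<lambda>j. \<bar>f (real (Suc j) / 2^n) - f (real j / 2^n)\<bar>"] by simp
  also have "\<dots> < e"
  proof (rule ac_modulusD[OF d], rule disjoint_ivlsI)
    show "finite ?J" using I(1) fin by auto
    show "real j / 2^n \<le> real (Suc j) / 2^n" for j by (simp add: divide_right_mono)
    fix i j :: nat assume "i \<noteq> j"
    then have "Suc i \<le> j \<or> Suc j \<le> i" by linarith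
    then have "real (Suc i) \<le> real j \<or> real (Suc j) \<le> real i" by linarith
    then show "real (Suc i) / 2^n \<le> real j / 2^n \<or> real (Suc j) / 2^n \<le> real i / 2^n"
      by (meson divide_right_mono zero_le_numeral zero_le_power)
  next
    have "(\<Sum>j\<in>?J. real (Suc j) / 2^n - real j / 2^n) = (\<Sum>i\<in>I. \<Sum>j\<in>A i. 1 / 2^n)"
      unfolding cell by (rule sum.UNION_disjoint[OF I(1) fin dj])
    also have "\<dots> = (\<Sum>i\<in>I. real (m (r i) - m (l i)) / 2^n)"
      by (simp add: A_def)
    also have "\<dots> \<le> (\<Sum>i\<in>I. r i - l i + 1/2^n)"
      unfolding m_def using I(2) by (intro sum_mono dyadic_cells_length) auto
    also have "\<dots> = (\<Sum>i\<in>I. r i - l i) + real (card I) / 2^n"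
      by (simp add: sum.distrib)
    finally show "(\<Sum>j\<in>?J. real (Suc j) / 2^n - real j / 2^n) < d" using len by simp
  qed
  finally show ?thesis .
qed

lemma inverse_power2_small:
  assumes "(d::real) > 0" obtains n where "\<forall>m\<ge>n. c / 2^m < d"
proof -
  have "(\<lambda>m. c * (1/2)^m) \<longlonglongrightarrow> c * 0"
    by (intro tendsto_mult tendsto_const LIMSEQ_realpow_zero) auto
  then have "eventually (\<lambda>m. c * (1/2)^m < d) sequentially"
    using assms by (intro order_tendstoD(2)) auto
  then obtain n where "\<forall>m\<ge>n. c * (1/2)^m < d" unfolding eventually_sequentially by blast
  moreover have "c * (1/2)^m = c / 2^m" for m by (simp add: power_divide)
  ultimately have "\<forall>m\<ge>n. c / 2^m < d" by metis
  then show thesis by (rule that)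
qed

text \<open>The modulus for \<open>e = 1\<close> bounds the gain over a step of length d/2 by 1 at
  all fine levels, so the number of steps needed to pass t bounds the variation. Coarse levels lie
  below fine ones.\<close>

lemma dyadic_var_bdd:
  assumes "acont f" shows "\<exists>B. \<forall>n. dyadic_var f n t \<le> B"
proof -
  obtain d where d: "d > 0" "ac_modulus f (1) d"
    by (rule acontE[OF assms zero_less_one])
  obtain n0 where n0: "\<forall>m\<ge>n0. 1 / 2^m < d/2"
    using inverse_power2_small[of "d/2" 1] d(1) by auto
  have step: "dyadic_var f n (s + d/2) \<le> dyadic_var f n s + 1" if "n \<ge> n0" for n s
    using dyadic_var_family[OF d(2), of "{0}" "\<lambda>_. s" "\<lambda>_. s + d/2" n] n0[rule_format, OF that] d(1)
    by (simp add: disjoint_ivls_def)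
  have it: "dyadic_var f n (real k * (d/2)) \<le> real k" if "n \<ge> n0" for n k
  proof (induction k)
    case 0 then show ?case by (simp add: dyadic_var_def)
  next
    case (Suc k)
    have "real (Suc k) * (d/2) = real k * (d/2) + d/2"
      by (simp add: field_simps)
    then show ?case using step[OF that, of "real k * (d/2)"] Suc
      by (simp only: of_nat_Suc)
  qed
  obtain k :: nat where k: "real k > t / (d/2)" using reals_Archimedean2 by blast
  then have tk: "t \<le> real k * (d/2)" using d(1) by (simp add: field_simps)
  have inc: "incseq (\<lambda>n. dyadic_var f n t)" by (intro incseq_SucI dyadic_var_Suc)
  have "dyadic_var f n t \<le> real k" for n
  proof -
    have "dyadic_var f n t \<le> dyadic_var f (max n n0) t" by (rule incseqD[OF inc]) simp
    also have "\<dots> \<le> dyadic_var f (max n n0) (real k * (d/2))" by (rule dyadic_var_mono[OF tk])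
    also have "\<dots> \<le> real k" by (rule it) simp
    finally show ?thesis .
  qed
  then show ?thesis by blast
qed

text \<open>V is the supremum over the dyadic levels. It makes V and V + f nondecreasing, which
  reduces differentiation to monotone functions. The increments of f are dominated at dyadic points
  by telescoping and in general by continuity; the modulus, being uniform in the level, survives the
  limit.\<close>

lemma acont_variation:
  fixes f :: "real \<Rightarrow> real"
  assumes f: "acont f" and const: "\<And>t. t \<le> 0 \<Longrightarrow> f t = f 0"
  obtains V where "acont V" "\<And>s t. s \<le> t \<Longrightarrow> \<bar>f t - f s\<bar> \<le> V t - V s"
proof -
  define V where "V = (\<lambda>t. SUP n. dyadic_var f n t)"
  have lim: "(\<lambda>n. dyadic_var f n t) \<longlonglongrightarrow> V t" for t
    unfolding V_def using dyadic_var_bdd[OF f, of t]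
    by (intro LIMSEQ_incseq_SUP incseq_SucI dyadic_var_Suc) (auto simp: bdd_above_def)
  have le: "\<bar>f t - f s\<bar> \<le> V t - V s" if st: "s \<le> t" for s t
  proof (rule LIMSEQ_le)
    show "(\<lambda>n. dyadic_var f n t - dyadic_var f n s) \<longlonglongrightarrow> V t - V s"
      by (intro tendsto_diff lim)
    \<comment> \<open>The grid starts at 0, so the approximations tend to \<open>max 0 x\<close>; f
      takes the same value there as at x because it is constant on the negative axis.\<close>
    have app: "(\<lambda>n. real (nat \<lfloor>2^n * x\<rfloor>) / 2^n) \<longlonglongrightarrow> max 0 x" for x :: real
    proof (rule real_tendsto_sandwich)
      have "(\<lambda>m. (1/2::real)^m) \<longlonglongrightarrow> 0" by (rule LIMSEQ_realpow_zero) auto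
      then have "(\<lambda>n. max 0 x - 1/2^n) \<longlonglongrightarrow> max 0 x - 0"
        by (intro tendsto_diff tendsto_const) (simp add: power_one_over)
      then show "(\<lambda>n. max 0 x - 1/2^n) \<longlonglongrightarrow> max 0 x" by simp
      show "(\<lambda>n. max 0 x) \<longlonglongrightarrow> max 0 x" by simp
      have "max 0 x - 1/2^n \<le> real (nat \<lfloor>2^n * x\<rfloor>) / 2^n \<and> real (nat \<lfloor>2^n * x\<rfloor>) / 2^n \<le> max 0 x" for n
      proof (cases "x < 0")
        case True
        then have "2^n * x \<le> 0" by (simp add: mult_nonneg_nonpos)
        then show ?thesis using True by simp
      next
        case False
        then have "2^n * x \<ge> 0" by simp
        then have "real (nat \<lfloor>2^n * x\<rfloor>) \<le> 2^n * x" "real (nat \<lfloor>2^n * x\<rfloor>) \<ge> 2^n * x - 1" by linarith+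
        then have "(2^n * x - 1) / 2^n \<le> real (nat \<lfloor>2^n * x\<rfloor>) / 2^n"
          "real (nat \<lfloor>2^n * x\<rfloor>) / 2^n \<le> (2^n * x) / 2^n"
          by (intro divide_right_mono; simp)+
        then show ?thesis using False by (simp add: diff_divide_distrib)
      qed
      then show "eventually (\<lambda>n. max 0 x - 1/2^n \<le> real (nat \<lfloor>2^n * x\<rfloor>) / 2^n) sequentially"
        "eventually (\<lambda>n. real (nat \<lfloor>2^n * x\<rfloor>) / 2^n \<le> max 0 x) sequentially" by auto
    qed
    have "f (max 0 x) = f x" for x using const[of x] by (simp add: max_def)
    moreover have "isCont f x" for x
      using acont_continuous[OF f] by (simp add: continuous_on_eq_continuous_at)
    ultimately have fl: "(\<lambda>n. f (real (nat \<lfloor>2^n * x\<rfloor>) / 2^n)) \<longlonglongrightarrow> f x" for x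
      using isCont_tendsto_compose[OF _ app, of x f] by metis
    show "(\<lambda>n. \<bar>f (real (nat \<lfloor>2^n * t\<rfloor>) / 2^n) - f (real (nat \<lfloor>2^n * s\<rfloor>) / 2^n)\<bar>) \<longlonglongrightarrow> \<bar>f t - f s\<bar>"
      by (intro tendsto_rabs tendsto_diff fl)
    have "\<bar>f (real (nat \<lfloor>2^n * t\<rfloor>) / 2^n) - f (real (nat \<lfloor>2^n * s\<rfloor>) / 2^n)\<bar>
       \<le> dyadic_var f n t - dyadic_var f n s" for n
    proof -
      have m: "nat \<lfloor>2^n * s\<rfloor> \<le> nat \<lfloor>2^n * t\<rfloor>"
        using st by (intro nat_mono floor_mono mult_left_mono) auto
      have "f (real (nat \<lfloor>2^n * t\<rfloor>) / 2^n) - f (real (nat \<lfloor>2^n * s\<rfloor>) / 2^n)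
        = (\<Sum>j\<in>{nat \<lfloor>2^n * s\<rfloor>..<nat \<lfloor>2^n * t\<rfloor>}. f (real (Suc j) / 2^n) - f (real j / 2^n))"
        using sum_Suc_diff'[OF m, of "\<lambda>j. f (real j / 2^n)"] by simp
      then show ?thesis unfolding dyadic_var_diff[OF st] by (simp add: sum_abs)
    qed
    then show "\<exists>N. \<forall>n\<ge>N. \<bar>f (real (nat \<lfloor>2^n * t\<rfloor>) / 2^n) - f (real (nat \<lfloor>2^n * s\<rfloor>) / 2^n)\<bar>
       \<le> dyadic_var f n t - dyadic_var f n s" by blast
  qed
  have mono: "V s \<le> V t" if "s \<le> t" for s t using le[OF that] by linarith
  have "acont V"
  proof (rule acontI)
    fix e :: real assume "e > 0"
    then have e2: "e / 2 > 0" by simp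
    obtain d where d: "d > 0" "ac_modulus f (e/2) d"
      by (rule acontE[OF f e2])
    show "\<exists>d>0. \<forall>I l r. disjoint_ivls I l r \<longrightarrow> (\<Sum>i\<in>I. r i - l i) < d
     \<longrightarrow> (\<Sum>i\<in>I. norm (V (r i) - V (l i))) < e"
    proof (intro exI[of _ d] conjI allI impI d(1))
      fix I :: "nat set" and l r :: "nat \<Rightarrow> real"
      assume dis: "disjoint_ivls I l r" and len: "(\<Sum>i\<in>I. r i - l i) < d"
      note lr = disjoint_ivlsD(2)[OF dis]
      obtain n0 where n0: "\<forall>m\<ge>n0. real (card I) / 2^m < d - (\<Sum>i\<in>I. r i - l i)"
        using inverse_power2_small[of "d - (\<Sum>i\<in>I. r i - l i)" "real (card I)"] len by auto
      have "(\<lambda>n. \<Sum>i\<in>I. dyadic_var f n (r i) - dyadic_var f n (l i)) \<longlonglongrightarrow> (\<Sum>i\<in>I. V (r i) - V (l i))"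
        by (intro tendsto_sum tendsto_diff lim)
      moreover have "(\<Sum>i\<in>I. dyadic_var f n (r i) - dyadic_var f n (l i)) \<le> e/2" if "n \<ge> n0" for n
        using n0[rule_format, OF that] by (intro less_imp_le dyadic_var_family[OF d(2) dis]) auto
      ultimately have "(\<Sum>i\<in>I. V (r i) - V (l i)) \<le> e/2"
        by (intro LIMSEQ_le_const2) auto
      moreover have "(\<Sum>i\<in>I. norm (V (r i) - V (l i))) = (\<Sum>i\<in>I. V (r i) - V (l i))"
        using lr mono by (intro sum.cong) auto
      ultimately show "(\<Sum>i\<in>I. norm (V (r i) - V (l i))) < e" using \<open>e > 0\<close> by simp
    qed
  qed
  then show thesis using le that by blast
qed


section \<open>Stieltjes measures and derivatives almost everywhere\<close>

lemma acont_mono_absolutely_continuous: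
  fixes F :: "real \<Rightarrow> real"
  assumes F: "acont F" and mono: "\<And>x y. x \<le> y \<Longrightarrow> F x \<le> F y"
  shows "absolutely_continuous lborel (interval_measure F)"
  unfolding absolutely_continuous_def
proof
  fix A :: "real set" assume A: "A \<in> null_sets lborel"
  let ?N = "interval_measure F"
  have cont: "continuous (at_right a) F" for a
    using acont_continuous[OF F] continuous_on_eq_continuous_at[of UNIV F] continuous_at_imp_continuous_at_within by blast
  have "emeasure ?N A \<le> ennreal e" if "e > 0" for e
  proof -
    obtain d where d: "d > 0" "ac_modulus F e d" using acontE[OF F \<open>e > 0\<close>] .
    have Ab: "A \<in> sets borel" "A \<in> sets lebesgue" "emeasure lebesgue A = 0"
      using A null_sets_completionI[OF A] by (auto simp: null_sets_def)
    obtain U where U: "open U" "A \<subseteq> U" "(U - A) \<in> lmeasurable" "emeasure lebesgue (U - A) < ennreal d"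
      using sets_lebesgue_outer_open[OF Ab(2) d(1)] by metis
    have "emeasure lborel U = emeasure lebesgue U" using U(1) by simp
    also have "\<dots> \<le> emeasure lebesgue (U - A) + emeasure lebesgue A"
      using U(1,2) Ab(2) emeasure_subadditive[of "U - A" lebesgue A] U(3)
      by (auto simp: Un_absorb2 fmeasurableD)
    finally have Ud: "emeasure lborel U < ennreal d" using U(4) Ab(3) by simp
    \<comment> \<open>Half-open cells are disjoint and have Stieltjes measure equal to the increment
      of F. The unions \<open>W n\<close> of cells inside U exhaust U; absolute continuity bounds
      the measure of each by e, and monotone convergence bounds the measure of U, hence of the null
      set A.\<close>
    define cell where "cell = (\<lambda>n j. {of_int j / 2^n <.. (of_int j + 1) / 2^n :: real})"
    define ccell where "ccell = (\<lambda>n j. {of_int j / 2^n .. (of_int j + 1) / 2^n :: real})"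
    define J where "J = (\<lambda>n::nat. {j::int. \<bar>j\<bar> \<le> int n * 2^n \<and> ccell n j \<subseteq> U})"
    define W where "W = (\<lambda>n. \<Union>j\<in>J n. cell n j)"
    have finJ: "finite (J n)" for n
      by (rule finite_subset[of _ "{- (int n * 2^n)..int n * 2^n}"]) (auto simp: J_def)
    have WU: "W n \<subseteq> U" for n by (force simp: W_def J_def cell_def ccell_def)
    have Wsets: "W n \<in> sets borel" for n by (auto simp: W_def cell_def)
    have halves: "cell n j \<subseteq> cell (Suc n) (2*j) \<union> cell (Suc n) (2*j+1)"
      "ccell (Suc n) (2*j) \<subseteq> ccell n j" "ccell (Suc n) (2*j+1) \<subseteq> ccell n j" for n j
      by (auto simp: cell_def ccell_def field_simps)
    have inc: "incseq W"
    proof (rule incseq_SucI, rule subsetI)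
      fix n x assume "x \<in> W n"
      then obtain j where j: "j \<in> J n" "x \<in> cell n j" by (auto simp: W_def)
      have "\<bar>2*j\<bar> \<le> int (Suc n) * 2^Suc n" "\<bar>2*j+1\<bar> \<le> int (Suc n) * 2^Suc n"
      proof -
        have "\<bar>j\<bar> \<le> int n * 2^n" using j by (simp add: J_def)
        moreover have "(1::int) \<le> 2^n" by simp
        moreover have "int (Suc n) * 2^Suc n = 2 * (int n * 2^n) + 2 * 2^n" by (simp add: algebra_simps)
        ultimately show "\<bar>2*j\<bar> \<le> int (Suc n) * 2^Suc n" "\<bar>2*j+1\<bar> \<le> int (Suc n) * 2^Suc n" by linarith+
      qed
      then have "2*j \<in> J (Suc n)" "2*j+1 \<in> J (Suc n)" using halves(2,3)[of n j] j(1) by (auto simp: J_def)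
      then show "x \<in> W (Suc n)" using halves(1)[of n j] j(2) unfolding W_def by blast
    qed
    have UW: "U \<subseteq> (\<Union>n. W n)"
    proof
      fix x assume "x \<in> U"
      then obtain r where r: "r > 0" "\<And>y. dist y x < r \<Longrightarrow> y \<in> U" using U(1) open_dist by metis
      obtain n0 where n0: "\<forall>m\<ge>n0. 1 / 2^m < r" using inverse_power2_small[OF r(1)] .
      obtain n1 :: nat where n1: "\<bar>x\<bar> + 1 \<le> real n1" using real_arch_simple by blast
      define n where "n = max n0 n1"
      have n: "1 / 2^n < r" "\<bar>x\<bar> + 1 \<le> real n" using n0 n1 by (auto simp: n_def)
      define j where "j = \<lceil>2^n * x\<rceil> - 1"
      have j: "of_int j < 2^n * x" "2^n * x \<le> of_int j + 1" unfolding j_def by linarith+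
      have "x \<in> cell n j" using j by (auto simp: cell_def field_simps)
      moreover have "ccell n j \<subseteq> U"
      proof
        fix y assume y: "y \<in> ccell n j"
        have "\<bar>y - x\<bar> \<le> (of_int j + 1) / 2^n - of_int j / 2^n"
          using y \<open>x \<in> cell n j\<close> unfolding ccell_def cell_def by auto
        also have "\<dots> = 1 / 2^n" by (simp add: add_divide_distrib)
        finally show "y \<in> U" using n(1) by (intro r(2)) (auto simp: dist_real_def)
      qed
      moreover have "\<bar>j\<bar> \<le> int n * 2^n"
      proof -
        have "2^n * \<bar>x\<bar> + 2^n \<le> 2^n * real n" using mult_left_mono[OF n(2), of "2^n"] by (simp add: algebra_simps)
        moreover have "(1::real) \<le> 2^n" by simp
        moreover have "2^n * x \<le> 2^n * \<bar>x\<bar>" "2^n * (- x) \<le> 2^n * \<bar>x\<bar>" by (intro mult_left_mono; simp)+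
        ultimately have "\<bar>real_of_int j\<bar> \<le> 2^n * real n" using j unfolding abs_le_iff by linarith
        then have "real_of_int \<bar>j\<bar> \<le> real_of_int (int n * 2^n)" by (simp add: mult.commute)
        then show ?thesis by (simp only: of_int_le_iff)
      qed
      ultimately have "x \<in> W n" by (auto simp: W_def J_def)
      then show "x \<in> (\<Union>n. W n)" by blast
    qed
    have cell_disj: "cell n i \<inter> cell n j = {}" if "i \<noteq> j" for n i j
    proof -
      have "of_int i + 1 \<le> (of_int j :: real) \<or> of_int j + 1 \<le> (of_int i :: real)" using that by linarith
      then have "(of_int i + 1) / 2^n \<le> (of_int j :: real) / 2^n \<or> (of_int j + 1) / 2^n \<le> (of_int i :: real) / 2^n"
        by (meson divide_right_mono zero_le_numeral zero_le_power)
      then show ?thesis by (auto simp: cell_def)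
    qed
    have cell_le: "of_int j / 2^n \<le> (of_int j + 1) / (2^n::real)" for j n by (simp add: divide_right_mono)
    have NW: "emeasure ?N (W n) \<le> ennreal e" for n
    proof -
      have dF: "disjoint_family_on (cell n) (J n)" using cell_disj by (auto simp: disjoint_family_on_def)
      have "emeasure ?N (W n) = (\<Sum>j\<in>J n. emeasure ?N (cell n j))"
        unfolding W_def using dF finJ by (intro sum_emeasure[symmetric]) (auto simp: cell_def)
      also have "\<dots> = (\<Sum>j\<in>J n. ennreal (F ((of_int j + 1) / 2^n) - F (of_int j / 2^n)))"
        unfolding cell_def by (intro sum.cong refl emeasure_interval_measure_Ioc cell_le mono cont)
      also have "\<dots> = ennreal (\<Sum>j\<in>J n. F ((of_int j + 1) / 2^n) - F (of_int j / 2^n))"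
        using mono cell_le by (intro sum_ennreal) (simp add: diff_ge_0_iff_ge)
      also have "\<dots> \<le> ennreal e"
      proof (intro ennreal_leI)
        obtain h where h: "bij_betw h {..<card (J n)} (J n)"
          using ex_bij_betw_nat_finite[OF finJ] by (auto simp: atLeast0LessThan)
        have len: "(\<Sum>j\<in>J n. (of_int j + 1) / 2^n - of_int j / (2^n::real)) < d"
        proof -
          have "ennreal (\<Sum>j\<in>J n. (of_int j + 1) / 2^n - of_int j / (2^n::real)) = (\<Sum>j\<in>J n. emeasure lborel (cell n j))"
            unfolding cell_def using cell_le by (subst sum_ennreal[symmetric]) (auto simp: diff_ge_0_iff_ge)
          also have "\<dots> = emeasure lborel (W n)"
            unfolding W_def using dF finJ by (intro sum_emeasure) (auto simp: cell_def)
          also have "\<dots> \<le> emeasure lborel U" using WU U(1) by (intro emeasure_mono) auto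
          finally have "ennreal (\<Sum>j\<in>J n. (of_int j + 1) / 2^n - of_int j / (2^n::real)) < ennreal d"
            using Ud by (rule le_less_trans)
          then show ?thesis using d(1) by (subst (asm) ennreal_less_iff) (auto intro!: sum_nonneg simp: cell_le)
        qed
        have "(\<Sum>i<card (J n). norm (F ((of_int (h i) + 1) / 2^n) - F (of_int (h i) / 2^n))) < e"
        proof (rule ac_modulusD[OF d(2)], rule disjoint_ivlsI)
          fix i j assume "i \<in> {..<card (J n)}" "j \<in> {..<card (J n)}" "i \<noteq> j"
          then have "h i \<noteq> h j" using h by (auto simp: bij_betw_def inj_on_def)
          then have "of_int (h i) + 1 \<le> (of_int (h j) :: real) \<or> of_int (h j) + 1 \<le> (of_int (h i) :: real)" by linarith
          then show "(of_int (h i) + 1) / 2^n \<le> (of_int (h j) :: real) / 2^n \<or> (of_int (h j) + 1) / 2^n \<le> (of_int (h i) :: real) / 2^n"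
            by (meson divide_right_mono zero_le_numeral zero_le_power)
        next
          show "(\<Sum>i<card (J n). (of_int (h i) + 1) / 2^n - of_int (h i) / (2^n::real)) < d"
            using len sum.reindex_bij_betw[OF h, of "\<lambda>j. (of_int j + 1) / 2^n - of_int j / (2^n::real)"] by simp
        qed (use cell_le in auto)
        then have "(\<Sum>j\<in>J n. norm (F ((of_int j + 1) / 2^n) - F (of_int j / 2^n))) < e"
          using sum.reindex_bij_betw[OF h, of "\<lambda>j. norm (F ((of_int j + 1) / 2^n) - F (of_int j / 2^n))"] by simp
        moreover have "(\<Sum>j\<in>J n. F ((of_int j + 1) / 2^n) - F (of_int j / 2^n)) \<le> (\<Sum>j\<in>J n. norm (F ((of_int j + 1) / 2^n) - F (of_int j / 2^n)))"
          by (intro sum_mono) simp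
        ultimately show "(\<Sum>j\<in>J n. F ((of_int j + 1) / 2^n) - F (of_int j / 2^n)) \<le> e" by linarith
      qed
      finally show ?thesis .
    qed
    have "(\<lambda>n. emeasure ?N (W n)) \<longlonglongrightarrow> emeasure ?N (\<Union>n. W n)"
      using inc Wsets by (intro Lim_emeasure_incseq) auto
    then have "emeasure ?N (\<Union>n. W n) \<le> ennreal e"
      by (rule LIMSEQ_le_const2) (use NW in auto)
    moreover have "emeasure ?N A \<le> emeasure ?N (\<Union>n. W n)"
      using U(2) UW Wsets by (intro emeasure_mono) auto
    ultimately show ?thesis by (rule order_trans[rotated])
  qed
  then have "emeasure ?N A = 0" by (metis ennreal_le_epsilon add_0 le_zero_eq)
  then show "A \<in> null_sets ?N" using A by (auto simp: null_sets_def)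
qed

text \<open>D is the Radon-Nikodym derivative of the Stieltjes measure. It is finite almost
  everywhere, so passing to reals by \<open>enn2real\<close> does not change its integrals.\<close>

lemma acont_mono_density:
  fixes F :: "real \<Rightarrow> real"
  assumes F: "acont F" and mono: "\<And>x y. x \<le> y \<Longrightarrow> F x \<le> F y"
  obtains D where "\<And>x. D x \<ge> 0" "\<And>a b. a \<le> b \<Longrightarrow> (D has_integral (F b - F a)) {a..b}"
proof -
  let ?N = "interval_measure F"
  have cont: "continuous (at_right a) F" for a
    using acont_continuous[OF F] continuous_on_eq_continuous_at[of UNIV F] continuous_at_imp_continuous_at_within by blast
  have ac: "absolutely_continuous lborel ?N" by (rule acont_mono_absolutely_continuous[OF F mono])
  have sf: "sigma_finite_measure ?N" by (rule sigma_finite_interval_measure[OF mono cont])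
  define D where "D = (\<lambda>x. enn2real (RN_deriv lborel ?N x))"
  have AE: "AE x in lborel. RN_deriv lborel ?N x \<noteq> \<infinity>"
    by (rule sigma_finite_measure.RN_deriv_finite[OF lborel.sigma_finite_measure_axioms sf ac]) simp
  have dens: "density lborel (RN_deriv lborel ?N) = ?N"
    using sigma_finite_measure.density_RN_deriv[OF lborel.sigma_finite_measure_axioms ac] by simp
  have D: "(D has_integral (F b - F a)) {a..b}" if ab: "a \<le> b" for a b
  proof -
    have "(\<integral>\<^sup>+x. ennreal (D x * indicator {a..b} x) \<partial>lborel) = (\<integral>\<^sup>+x. RN_deriv lborel ?N x * indicator {a..b} x \<partial>lborel)"
      by (rule nn_integral_cong_AE) (use AE in \<open>auto simp: D_def indicator_def less_top split: if_splits\<close>)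
    also have "\<dots> = emeasure (density lborel (RN_deriv lborel ?N)) {a..b}"
      by (subst emeasure_density) auto
    also have "\<dots> = ennreal (F b - F a)"
      unfolding dens using emeasure_interval_measure_Icc[OF ab mono acont_continuous[OF F]] by simp
    finally have *: "(\<integral>\<^sup>+x. ennreal (D x * indicator {a..b} x) \<partial>lborel) = ennreal (F b - F a)" .
    have "((\<lambda>x. D x * indicator {a..b} x) has_integral (F b - F a)) UNIV"
      using * mono[OF ab] by (intro nn_integral_has_integral) (auto simp: D_def)
    moreover have "(\<lambda>x. D x * indicator {a..b} x) = (\<lambda>x. if x \<in> {a..b} then D x else 0)"
      by (auto simp: indicator_def)
    ultimately show ?thesis using has_integral_restrict_UNIV[of "{a..b}" D "F b - F a"] by simp
  qed
  show thesis by (rule that[of D]) (use D in \<open>auto simp: D_def\<close>)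
qed

text \<open>The differentiation theorem applied here speaks of quotients with h > 0. Applying it to
  \<open>\<lambda>x. D (- x)\<close> as well yields the left-hand quotients, with a reflected
  exceptional set.\<close>

lemma indefinite_integral_AE_derivative:
  fixes D F :: "real \<Rightarrow> real"
  assumes D: "\<And>a b. a \<le> b \<Longrightarrow> (D has_integral (F b - F a)) {a..b}"
  obtains N where "negligible N" "\<And>x. x \<notin> N \<Longrightarrow> (F has_real_derivative D x) (at x)"
proof -
  have int: "D integrable_on cbox a b" for a b :: real
    using D[of a b] by (cases "a \<le> b") auto
  obtain N1 where N1: "negligible N1" "\<And>x e. \<lbrakk>x \<notin> N1; 0 < e\<rbrakk> \<Longrightarrow>
               \<exists>d>0. \<forall>h. 0 < h \<and> h < d \<longrightarrow>
                         norm(integral (cbox x (x + h *\<^sub>R One)) D /\<^sub>R h ^ DIM(real) - D x) < e"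
    using integrable_ccontinuous_explicit[of D, OF int] by blast
  have Dm: "((\<lambda>x. D (-x)) has_integral (F (-a) - F (-b))) {a..b}" if "a \<le> b" for a b
    using has_integral_reflect_lemma_real[OF D[of "-b" "-a"]] that by simp
  have intm: "(\<lambda>x. D (-x)) integrable_on cbox a b" for a b :: real
    using Dm[of a b] by (cases "a \<le> b") auto
  obtain N2 where N2: "negligible N2" "\<And>x e. \<lbrakk>x \<notin> N2; 0 < e\<rbrakk> \<Longrightarrow>
               \<exists>d>0. \<forall>h. 0 < h \<and> h < d \<longrightarrow>
                         norm(integral (cbox x (x + h *\<^sub>R One)) (\<lambda>x. D (-x)) /\<^sub>R h ^ DIM(real) - D (-x)) < e"
    using integrable_ccontinuous_explicit[of "\<lambda>x. D (-x)", OF intm] by blast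
  have "negligible (uminus ` N2)"
    using N2(1) by (intro negligible_differentiable_image_negligible) (auto simp: differentiable_on_minus)
  then have neg: "negligible (N1 \<union> uminus ` N2)" using N1(1) by simp
  have "(F has_real_derivative D x) (at x)" if x: "x \<notin> N1 \<union> uminus ` N2" for x
  proof -
    have "x \<notin> N1" "-x \<notin> N2" using x by (auto simp: image_iff)
    have "\<exists>d>0. \<forall>h. h \<noteq> 0 \<and> \<bar>h\<bar> < d \<longrightarrow> \<bar>(F (x + h) - F x) / h - D x\<bar> < e" if "e > 0" for e
    proof -
      obtain d1 where d1: "d1 > 0" "\<And>h. 0 < h \<Longrightarrow> h < d1 \<Longrightarrow> norm(integral (cbox x (x + h *\<^sub>R One)) D /\<^sub>R h ^ DIM(real) - D x) < e"
        using N1(2)[OF \<open>x \<notin> N1\<close> \<open>e > 0\<close>] by blast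
      obtain d2 where d2: "d2 > 0" "\<And>h. 0 < h \<Longrightarrow> h < d2 \<Longrightarrow> norm(integral (cbox (-x) (-x + h *\<^sub>R One)) (\<lambda>x. D (-x)) /\<^sub>R h ^ DIM(real) - D (-(-x))) < e"
        using N2(2)[OF \<open>-x \<notin> N2\<close> \<open>e > 0\<close>] by blast
      have "\<bar>(F (x + h) - F x) / h - D x\<bar> < e" if h: "h \<noteq> 0" "\<bar>h\<bar> < min d1 d2" for h
      proof (cases "h > 0")
        case True
        have "integral {x..x+h} D = F (x + h) - F x" using D[of x "x+h"] True by (intro integral_unique) auto
        then show ?thesis using d1(2)[of h] h True by (simp add: divide_inverse mult.commute)
      next
        case False
        then have hn: "-h > 0" using h by simp
        have "integral {-x..-x + (-h)} (\<lambda>x. D (-x)) = F (-(-x)) - F (-(-x + (-h)))"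
          using Dm[of "-x" "-x + (-h)"] hn by (intro integral_unique) auto
        then have "integral {-x..-x + (-h)} (\<lambda>x. D (-x)) = F x - F (x + h)" by (simp add: add.commute)
        moreover have "norm (integral {-x..-x + (-h)} (\<lambda>x. D (-x)) / (-h) - D x) < e"
          using d2(2)[of "-h"] h hn by (simp add: divide_inverse mult.commute)
        moreover have "(F x - F (x + h)) / (-h) = (F (x + h) - F x) / h" using h by (simp add: field_simps)
        ultimately show ?thesis by simp
      qed
      then show ?thesis using d1 d2 by (intro exI[of _ "min d1 d2"]) auto
    qed
    then have "(\<lambda>h. (F (x + h) - F x) / h) \<midarrow>0\<rightarrow> D x"
      unfolding LIM_eq by (simp add: real_norm_def)
    then show ?thesis by (simp add: DERIV_def)
  qed
  then show thesis using that neg by blast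
qed

text \<open>Jordan decomposition: f is the difference of the nondecreasing functions V + f and V.
  Their densities are nonnegative, which upgrades gauge integrability of D to absolute
  integrability.\<close>

lemma acont_real_derivative:
  fixes f :: "real \<Rightarrow> real"
  assumes f: "acont f" and const: "\<And>t. t \<le> 0 \<Longrightarrow> f t = f 0"
  obtains D N where "\<And>a b. a \<le> b \<Longrightarrow> (D has_integral (f b - f a)) {a..b}"
    "\<And>a b. D absolutely_integrable_on {a..b}"
    "negligible N" "\<And>t. t \<notin> N \<Longrightarrow> (f has_real_derivative D t) (at t)"
proof -
  obtain V where V: "acont V" "\<And>s t. s \<le> t \<Longrightarrow> \<bar>f t - f s\<bar> \<le> V t - V s"
    using acont_variation[OF f const] by blast
  have monoV: "V s \<le> V t" if "s \<le> t" for s t using V(2)[OF that] by linarith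
  obtain D1 where D1: "\<And>x. D1 x \<ge> 0" "\<And>a b. a \<le> b \<Longrightarrow> (D1 has_integral (V b - V a)) {a..b}"
    using acont_mono_density[OF V(1) monoV] by blast
  have ac2: "acont (\<lambda>t. V t + f t)"
    by (rule acont_le_add[OF V(1) f]) (simp add: abs_triangle_ineq add_diff_add)
  have mono2: "V s + f s \<le> V t + f t" if "s \<le> t" for s t using V(2)[OF that] by linarith
  obtain D2 where D2: "\<And>x. D2 x \<ge> 0" "\<And>a b. a \<le> b \<Longrightarrow> (D2 has_integral ((V b + f b) - (V a + f a))) {a..b}"
    using acont_mono_density[OF ac2 mono2] by blast
  define D where "D = (\<lambda>t. D2 t - D1 t)"
  have D: "(D has_integral (f b - f a)) {a..b}" if "a \<le> b" for a b
    using has_integral_diff[OF D2(2)[OF that] D1(2)[OF that]] by (simp add: D_def)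
  have "D absolutely_integrable_on {a..b}" for a b
  proof (cases "a \<le> b")
    case True
    then show ?thesis unfolding D_def
      using D1(1) D2(1) has_integral_integrable[OF D1(2)[OF True]] has_integral_integrable[OF D2(2)[OF True]]
      by (intro set_integral_diff nonnegative_absolutely_integrable_1) auto
  qed simp
  moreover obtain N where "negligible N" "\<And>x. x \<notin> N \<Longrightarrow> (f has_real_derivative D x) (at x)"
    using indefinite_integral_AE_derivative[of D f, OF D] by blast
  ultimately show thesis using that[of D N] D by blast
qed

section \<open>Snell's law and strip crossings\<close>

text \<open>A dual bound: \<sigma> is the Lagrange multiplier of the unit climb, and p + q is
  subtracted because the same horizontal distance costs p + q along a grid line.\<close>

definition snell_gap :: "real \<Rightarrow> real \<Rightarrow> real \<Rightarrow> real \<Rightarrow> real" where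
  "snell_gap \<beta> p q \<sigma> = p * (sqrt (1 - \<sigma>\<^sup>2) - 1) + q * (sqrt (\<beta>\<^sup>2 - \<sigma>\<^sup>2) - 1) + \<sigma>"

text \<open>A quarter circle is concave, so it lies below its tangent at s; algebraically this is
  Cauchy-Schwarz for two points of the circle of radius R.\<close>

lemma sqrt_diff_squares_tangent:
  assumes "0 \<le> s" "s < R" "0 \<le> t" "t \<le> R"
  shows "sqrt (R\<^sup>2 - t\<^sup>2) \<le> sqrt (R\<^sup>2 - s\<^sup>2) - s * (t - s) / sqrt (R\<^sup>2 - s\<^sup>2)"
proof -
  have R: "R\<^sup>2 - s\<^sup>2 > 0" "R\<^sup>2 - t\<^sup>2 \<ge> 0"
    using assms by (auto simp: power_strict_mono power_mono)
  let ?a = "sqrt (R\<^sup>2 - s\<^sup>2)" and ?b = "sqrt (R\<^sup>2 - t\<^sup>2)"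
  have a: "?a > 0" "?a\<^sup>2 = R\<^sup>2 - s\<^sup>2" "?b\<^sup>2 = R\<^sup>2 - t\<^sup>2" using R by auto
  have "?a * ?b + s * t \<le> R\<^sup>2"
    using sum_squares_ge_zero[of "?a - ?b" "s - t"] a(2,3) by (simp add: power2_eq_square algebra_simps)
  then have "?b * ?a \<le> ?a\<^sup>2 - s * (t - s)" using a(2) by (simp add: power2_eq_square algebra_simps)
  then have "?b \<le> (?a\<^sup>2 - s * (t - s)) / ?a" using a(1) by (simp add: pos_le_divide_eq)
  also have "\<dots> = ?a - s * (t - s) / ?a"
  proof -
    have "(x\<^sup>2 - y) / x = x - y / x" if "x > 0" for x y :: real
      using that by (simp add: field_simps power2_eq_square)
    then show ?thesis using a(1) by blast
  qed
  finally show ?thesis .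
qed

text \<open>The gap is concave in the sine, and its derivative is 1 minus the left side of
  \<open>eq\<close>; Snell's law thus marks the maximum.\<close>

lemma snell_gap_max:
  assumes "\<beta> > 1" "p \<ge> 0" "q \<ge> 0" "0 \<le> s" "s < 1" "0 \<le> t" "t \<le> 1"
    and eq: "p * s / sqrt (1 - s\<^sup>2) + q * s / sqrt (\<beta>\<^sup>2 - s\<^sup>2) = 1"
  shows "snell_gap \<beta> p q t \<le> snell_gap \<beta> p q s"
proof -
  have 1: "sqrt (1 - t\<^sup>2) \<le> sqrt (1 - s\<^sup>2) - s * (t - s) / sqrt (1 - s\<^sup>2)"
    using sqrt_diff_squares_tangent[of s 1 t] assms by simp
  have 2: "sqrt (\<beta>\<^sup>2 - t\<^sup>2) \<le> sqrt (\<beta>\<^sup>2 - s\<^sup>2) - s * (t - s) / sqrt (\<beta>\<^sup>2 - s\<^sup>2)"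
    using sqrt_diff_squares_tangent[of s \<beta> t] assms by simp
  have "snell_gap \<beta> p q t \<le> p * (sqrt (1 - s\<^sup>2) - s * (t - s) / sqrt (1 - s\<^sup>2) - 1)
      + q * (sqrt (\<beta>\<^sup>2 - s\<^sup>2) - s * (t - s) / sqrt (\<beta>\<^sup>2 - s\<^sup>2) - 1) + t"
    unfolding snell_gap_def using 1 2 assms by (intro add_mono mult_left_mono) auto
  also have "\<dots> = snell_gap \<beta> p q s + (t - s) * (1 - (p * s / sqrt (1 - s\<^sup>2) + q * s / sqrt (\<beta>\<^sup>2 - s\<^sup>2)))"
    by (simp add: snell_gap_def algebra_simps)
  finally show ?thesis unfolding eq by simp
qed

lemma snell_ex1:
  assumes "\<beta> > 1" "p \<ge> 1" "q \<ge> 0"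
  shows "\<exists>!s::real. 0 < s \<and> s < 1 \<and> p * s / sqrt (1 - s\<^sup>2) + q * s / sqrt (\<beta>\<^sup>2 - s\<^sup>2) = 1"
proof (rule ex_ex1I)
  let ?g = "\<lambda>s. p * s / sqrt (1 - s\<^sup>2) + q * s / sqrt (\<beta>\<^sup>2 - s\<^sup>2)"
  \<comment> \<open>At this sine \<open>sqrt (1 - b\<^sup>2)\<close> equals \<open>b\<close>, so the
    first summand alone is \<open>p\<close>, which is at least 1.\<close>
  define b :: real where "b = sqrt (1/2)"
  have b: "0 < b" "b < 1" "b\<^sup>2 = 1/2" by (auto simp: b_def)
  have pos: "1 - s\<^sup>2 > 0" "\<beta>\<^sup>2 - s\<^sup>2 > 0" if "0 \<le> s" "s < 1" for s
    using that assms(1) power_strict_mono[of s 1 2] power_strict_mono[of s \<beta> 2] by auto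
  have "sqrt (1 - b\<^sup>2) = b" unfolding b(3) by (simp add: b_def)
  then have gb: "1 \<le> ?g b"
    using b assms pos[of b] by (auto intro!: add_increasing2 divide_nonneg_nonneg)
  have "continuous_on {0..b} ?g"
  proof (intro continuous_intros ballI)
    fix x assume "x \<in> {0..b}"
    then have "1 - x\<^sup>2 > 0" "\<beta>\<^sup>2 - x\<^sup>2 > 0" using b by (intro pos; simp)+
    then show "sqrt (1 - x\<^sup>2) \<noteq> 0" "sqrt (\<beta>\<^sup>2 - x\<^sup>2) \<noteq> 0" by simp_all
  qed
  then obtain s where s: "0 \<le> s" "s \<le> b" "?g s = 1"
    using IVT'[of ?g 0 1 b] gb b by auto
  then have "s \<noteq> 0" by auto
  then show "\<exists>s. 0 < s \<and> s < 1 \<and> ?g s = 1" using s b by (intro exI[of _ s]) auto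
  have less: "?g s < ?g t" if st: "0 < s" "s < t" "t < 1" for s t
  proof -
    have sq: "s\<^sup>2 < t\<^sup>2" using st by (intro power_strict_mono) auto
    have "p * s / sqrt (1 - s\<^sup>2) < p * t / sqrt (1 - t\<^sup>2)"
      using st assms pos[of t] sq by (intro frac_less) auto
    moreover have "q * s / sqrt (\<beta>\<^sup>2 - s\<^sup>2) \<le> q * t / sqrt (\<beta>\<^sup>2 - t\<^sup>2)"
      using st assms pos[of t] sq by (intro frac_le) (auto intro: mult_left_mono)
    ultimately show ?thesis by simp
  qed
  fix s t assume "0 < s \<and> s < 1 \<and> ?g s = 1" "0 < t \<and> t < 1 \<and> ?g t = 1"
  then show "s = t" using less[of s t] less[of t s] by (cases s t rule: linorder_cases) auto
qed

lemma pf_qf_even: "qf (2 * real k) = real k" "pf (2 * real k) = real k + 1"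
proof -
  have "\<lfloor>2 * real k\<rfloor> = 2 * int k" by linarith
  then show "qf (2 * real k) = real k" by (simp add: qf_def)
  then show "pf (2 * real k) = real k + 1" by (simp add: pf_def)
qed

definition snell_sine :: "real \<Rightarrow> nat \<Rightarrow> real" where
  "snell_sine \<beta> k = sigma_hat (2 * real k) \<beta>"

text \<open>The cost of the refracted path through k + 1 light and k dark cells beyond its
  horizontal length 2 k + 1.\<close>

definition strip_excess :: "real \<Rightarrow> nat \<Rightarrow> real" where
  "strip_excess \<beta> k = snell_gap \<beta> (real k + 1) (real k) (snell_sine \<beta> k)"

context
  fixes \<beta> :: real
  assumes \<beta>: "\<beta> > 1"
begin

lemma snell_sine:
  shows "0 < snell_sine \<beta> k" "snell_sine \<beta> k < 1"
    "(real k + 1) * snell_sine \<beta> k / sqrt (1 - (snell_sine \<beta> k)\<^sup>2)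
      + real k * snell_sine \<beta> k / sqrt (\<beta>\<^sup>2 - (snell_sine \<beta> k)\<^sup>2) = 1"
  using theI'[OF snell_ex1[OF \<beta>, of "real k + 1" "real k"]]
  by (simp_all add: snell_sine_def sigma_hat_def pf_qf_even)

lemma snell_sine_radicands:
  "1 - (snell_sine \<beta> k)\<^sup>2 > 0" "\<beta>\<^sup>2 - (snell_sine \<beta> k)\<^sup>2 > 0"
  using snell_sine[of k] \<beta> power_strict_mono[of "snell_sine \<beta> k" 1 2] power_strict_mono[of "snell_sine \<beta> k" \<beta> 2] by auto

text \<open>Primal and dual values agree: writing 1 = a^2 + s^2 and \<beta>^2 = b^2 + s^2 in the
  numerators splits each term, and Snell's law collects the parts with s^2 into s.\<close>

lemma lf_even: "lf (2 * real k) \<beta> + sqrt 2 - 1 = strip_excess \<beta> k"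
proof -
  define s where "s = snell_sine \<beta> k"
  define a b where "a = sqrt (1 - s\<^sup>2)" and "b = sqrt (\<beta>\<^sup>2 - s\<^sup>2)"
  have ab: "a > 0" "b > 0" "a\<^sup>2 = 1 - s\<^sup>2" "b\<^sup>2 = \<beta>\<^sup>2 - s\<^sup>2"
    using snell_sine_radicands[of k] by (auto simp: a_def b_def s_def)
  have eq: "(real k + 1) * s / a + real k * s / b = 1" using snell_sine(3)[of k] by (simp add: s_def a_def b_def)
  have "(real k + 1) / a = (real k + 1) * (a\<^sup>2 + s\<^sup>2) / a" using ab by simp
  also have "\<dots> = (real k + 1) * a + s * ((real k + 1) * s / a)" using ab(1) by (simp add: field_simps power2_eq_square)
  finally have 1: "(real k + 1) / a = (real k + 1) * a + s * ((real k + 1) * s / a)" .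
  have "\<beta>\<^sup>2 * real k / b = real k * (b\<^sup>2 + s\<^sup>2) / b" using ab by simp
  also have "\<dots> = real k * b + s * (real k * s / b)" using ab(2) by (simp add: field_simps power2_eq_square)
  finally have 2: "\<beta>\<^sup>2 * real k / b = real k * b + s * (real k * s / b)" .
  have "(real k + 1) / a + \<beta>\<^sup>2 * real k / b = (real k + 1) * a + real k * b + s * ((real k + 1) * s / a + real k * s / b)"
    unfolding 1 2 by (simp add: algebra_simps)
  then have "(real k + 1) / a + \<beta>\<^sup>2 * real k / b = (real k + 1) * a + real k * b + s" unfolding eq by simp
  moreover have "lf (2 * real k) \<beta> = (real k + 1) / a + \<beta>\<^sup>2 * real k / b - 2 * real k - sqrt 2"
    by (simp add: lf_def Let_def pf_qf_even a_def b_def s_def snell_sine_def)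
  ultimately show ?thesis
    unfolding strip_excess_def snell_gap_def s_def[symmetric] a_def[symmetric] b_def[symmetric]
    by (simp add: algebra_simps)
qed

lemma snell_gap_le_strip_excess:
  assumes "0 \<le> t" "t \<le> 1"
  shows "snell_gap \<beta> (real k + 1) (real k) t \<le> strip_excess \<beta> k"
  unfolding strip_excess_def using snell_sine[of k] \<beta> assms by (intro snell_gap_max) auto

lemma delta_eq: "delta k \<beta> = strip_excess \<beta> (Suc k) - strip_excess \<beta> k"
  using lf_even[of k] lf_even[of "Suc k"] by (simp add: delta_def algebra_simps)

text \<open>The excess is a maximum of functions affine in \<open>k\<close>, hence convex in \<open>k\<close>.\<close>

lemma delta_mono: "delta k \<beta> \<le> delta (Suc k) \<beta>"
proof -
  let ?s = "snell_sine \<beta> (Suc k)"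
  have s: "0 \<le> ?s" "?s \<le> 1" using snell_sine[of "Suc k"] by auto
  have "snell_gap \<beta> (real k + 1) (real k) ?s + snell_gap \<beta> (real (Suc (Suc k)) + 1) (real (Suc (Suc k))) ?s
    = 2 * strip_excess \<beta> (Suc k)"
    by (simp add: snell_gap_def strip_excess_def algebra_simps)
  then show ?thesis
    using snell_gap_le_strip_excess[OF s, of k] snell_gap_le_strip_excess[OF s, of "Suc (Suc k)"]
    unfolding delta_eq by linarith
qed

text \<open>Testing with the sine 0 shows that the excess is at least k (\<beta> - 1), hence
  unbounded. This is what makes \<open>LEAST\<close> in \<open>k_c\<close> meaningful.\<close>

lemma delta_eventually_pos: "\<exists>k. delta k \<beta> > 0"
proof (rule ccontr)
  assume "\<nexists>k. delta k \<beta> > 0"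
  then have "strip_excess \<beta> (Suc k) \<le> strip_excess \<beta> k" for k
    by (metis delta_eq diff_gt_0_iff_gt not_le)
  then have dec: "strip_excess \<beta> k \<le> strip_excess \<beta> 0" for k
    by (induction k) (auto intro: order_trans)
  obtain k :: nat where "real k > strip_excess \<beta> 0 / (\<beta> - 1)" using reals_Archimedean2 by blast
  then have "strip_excess \<beta> 0 < real k * (\<beta> - 1)" using \<beta> by (simp add: field_simps)
  also have "\<dots> = snell_gap \<beta> (real k + 1) (real k) 0" using \<beta> by (simp add: snell_gap_def)
  also have "\<dots> \<le> strip_excess \<beta> k" by (rule snell_gap_le_strip_excess) auto
  finally show False using dec[of k] by simp
qed

text \<open>The differences are nondecreasing, so they are nonpositive before \<open>k_c\<close> and
  positive from there on.\<close>

lemma strip_excess_min: "strip_excess \<beta> (k_c \<beta>) \<le> strip_excess \<beta> k"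
proof -
  have pos: "delta (k_c \<beta>) \<beta> > 0" unfolding k_c_def using delta_eventually_pos by (rule LeastI_ex)
  have neg: "delta j \<beta> \<le> 0" if "j < k_c \<beta>" for j
    using not_less_Least[of j "\<lambda>k. delta k \<beta> > 0"] that by (simp add: k_c_def not_less)
  have up: "delta (k_c \<beta> + j) \<beta> > 0" for j
  proof (induction j)
    case 0 show ?case using pos by simp
  next
    case (Suc j) then show ?case using delta_mono[of "k_c \<beta> + j"] by simp
  qed
  show ?thesis
  proof (cases "k \<ge> k_c \<beta>")
    case True
    have "strip_excess \<beta> (k_c \<beta>) \<le> strip_excess \<beta> (k_c \<beta> + j)" for j
    proof (induction j)
      case (Suc j) then show ?case using up[of j] by (simp add: delta_eq)
    qed simp
    then show ?thesis using True by (metis le_Suc_ex)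
  next
    case False
    have "j \<le> k_c \<beta> \<Longrightarrow> strip_excess \<beta> (k_c \<beta>) \<le> strip_excess \<beta> (k_c \<beta> - j)" for j
    proof (induction j)
      case (Suc j)
      have "k_c \<beta> - j = Suc (k_c \<beta> - Suc j)" using Suc.prems by simp
      then show ?case using Suc neg[of "k_c \<beta> - Suc j"] by (simp add: delta_eq)
    qed simp
    from this[of "k_c \<beta> - k"] False show ?thesis by simp
  qed
qed

end

section \<open>Inequalities for the critical crossing\<close>

lemma sqrt_le_affine: "u \<ge> 0 \<Longrightarrow> \<kappa> > 0 \<Longrightarrow> sqrt u \<le> (u / \<kappa> + \<kappa>) / 2"
proof -
  assume u: "u \<ge> 0" "\<kappa> > 0"
  have "0 \<le> (sqrt u - \<kappa>)\<^sup>2" by simp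
  then have "2 * sqrt u * \<kappa> \<le> u + \<kappa>\<^sup>2" using u by (simp add: power2_diff)
  then show ?thesis using u by (simp add: field_simps power2_eq_square)
qed

text \<open>The next two lemmas serve the comparison with the critical crossing below, for \<open>k = 0\<close> and for
  \<open>k = n - 1 > 0\<close>. The former is tight up to \<open>0.017\<close> at \<open>s = sqrt (1/2)\<close>, hence the ad hoc constants:
  \<open>47/50\<close> and \<open>59/50\<close> approximate the two square roots there.\<close>

lemma critical_gap_one:
  fixes s g :: real
  assumes g: "0 \<le> g" "g \<le> s" and s: "s\<^sup>2 \<le> 1/2"
  shows "g + 2 * sqrt (1 - g\<^sup>2) + sqrt (1 + s\<^sup>2 - g\<^sup>2) \<le> s + sqrt (1 - s\<^sup>2) + 2"
proof -
  \<comment> \<open>442/625 is sqrt (1/2) rounded up.\<close>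
  have s1: "s \<le> 442/625"
    by (rule power2_le_imp_le) (use s in \<open>auto simp: power2_eq_square\<close>)
  have gs: "g\<^sup>2 \<le> s\<^sup>2" using g by (intro power_mono) auto
  \<comment> \<open>Essentially the chord of sqrt (1 - x) over [0, 1/2] with x = s^2; 2929/5000 is 2
    - sqrt 2 rounded up.\<close>
  have c: "sqrt (1 - s\<^sup>2) \<ge> 1 - 2929/5000 * s\<^sup>2"
  proof (rule real_le_rsqrt)
    define x where "x = s\<^sup>2"
    have x: "0 \<le> x" "x \<le> 1/2" using s by (auto simp: x_def)
    have "x * x \<le> x * (1/2)" using x by (intro mult_left_mono) auto
    moreover have "(1 - 2929/5000 * x)\<^sup>2 = 1 - 2929/2500 * x + 8579041/25000000 * (x * x)"
      by (simp add: power2_eq_square algebra_simps)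
    ultimately show "(1 - 2929/5000 * s\<^sup>2)\<^sup>2 \<le> 1 - s\<^sup>2"
      unfolding x_def[symmetric] using x by linarith
  qed
  show ?thesis
  proof (cases "s \<le> 1/2")
    case True
    have 1: "sqrt (1 - g\<^sup>2) \<le> 1 - g\<^sup>2 / 2"
      using sqrt_le_affine[of "1 - g\<^sup>2" 1] gs s by simp
    have 2: "sqrt (1 + s\<^sup>2 - g\<^sup>2) \<le> 1 + s\<^sup>2 / 2 - g\<^sup>2 / 2"
      using sqrt_le_affine[of "1 + s\<^sup>2 - g\<^sup>2" 1] gs by (simp add: field_simps)
    \<comment> \<open>The quadratic in g is least at g = 1/3; the cases ask whether s reaches that
      point. If so, s^2 is replaced by its chord over [1/3, 1/2].\<close>
    have "s - (5429/5000) * s\<^sup>2 - g + (3/2) * g\<^sup>2 \<ge> 0"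
    proof (cases "s \<le> 1/3")
      case True
      have "(s - g) * (1 - (3/2) * (s + g)) \<ge> 0" using True g by (intro mult_nonneg_nonneg) auto
      then have "s - g \<ge> (3/2) * s\<^sup>2 - (3/2) * g\<^sup>2" by (simp add: power2_eq_square field_simps)
      then show ?thesis using zero_le_power2[of s] by linarith
    next
      case False
      have "(s - 1/3) * (1/2 - s) \<ge> 0" using False \<open>s \<le> 1/2\<close> by (intro mult_nonneg_nonneg) auto
      then have "s\<^sup>2 \<le> 5/6 * s - 1/6" by (simp add: power2_eq_square algebra_simps)
      moreover have "(g - 1/3)\<^sup>2 \<ge> 0" by simp
      then have "(3/2) * g\<^sup>2 - g \<ge> -1/6" by (simp add: power2_eq_square algebra_simps)
      ultimately show ?thesis using False by linarith
    qed
    then show ?thesis using 1 2 c by linarith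
  next
    case False
    have 1: "sqrt (1 - g\<^sup>2) \<le> ((1 - g\<^sup>2) / (47/50) + 47/50) / 2"
      using gs s by (intro sqrt_le_affine) auto
    have 2: "sqrt (1 + s\<^sup>2 - g\<^sup>2) \<le> ((1 + s\<^sup>2 - g\<^sup>2) / (59/50) + 59/50) / 2"
      using gs by (intro sqrt_le_affine) auto
    \<comment> \<open>s^2 is replaced by its chord over [1/2, 442/625] and g^2 by its tangent at
      17/50, close to the g where the claim is tightest at s = sqrt (1/2). What remains is linear in
      s and g.\<close>
    have "(s - 1/2) * (442/625 - s) \<ge> 0" using False s1 by (intro mult_nonneg_nonneg) auto
    then have s2: "s\<^sup>2 \<le> 1509/1250 * s - 221/625" by (simp add: power2_eq_square field_simps)
    have "(g - 17/50)\<^sup>2 \<ge> 0" by simp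
    then have g2: "g\<^sup>2 \<ge> 17/25 * g - 289/2500" by (simp add: power2_eq_square field_simps)
    show ?thesis using 1 2 c s2 g2 False s1 g
      by (simp add: field_simps)
  qed
qed

lemma critical_gap_ge_two:
  fixes s g n :: real
  assumes n: "n \<ge> 2" and g: "0 \<le> g" "g \<le> s" and s: "(2*n - 1) * s \<le> 1"
  shows "g + (n+1) * sqrt (1 - g\<^sup>2) + n * sqrt (1 + s\<^sup>2 - g\<^sup>2) \<le> s + n * sqrt (1 - s\<^sup>2) + n + 1"
proof -
  have s0: "s \<ge> 0" using g by simp
  have "3 * s \<le> (2*n - 1) * s" using n s0 by (intro mult_right_mono) auto
  then have s3: "s \<le> 1/3" using s by linarith
  have s9: "s\<^sup>2 \<le> 1/9" using power_mono[OF s3 s0, of 2] by (simp add: power2_eq_square)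
  have gs: "g\<^sup>2 \<le> s\<^sup>2" using g by (intro power_mono) auto
  \<comment> \<open>With x = s^2 the Taylor coefficient of x^2 is -1/8; lowering it to -1/4 absorbs
    the remainder for x up to 1/9.\<close>
  have c: "sqrt (1 - s\<^sup>2) \<ge> 1 - s\<^sup>2 / 2 - (s\<^sup>2)\<^sup>2 / 4"
  proof (rule real_le_rsqrt)
    define x where "x = s\<^sup>2"
    have x: "0 \<le> x" "x \<le> 1/9" using s9 by (auto simp: x_def)
    have "x * x \<le> x * (1/9)" using x by (intro mult_left_mono) auto
    then have "x / 4 + x * x / 16 \<le> 1/4" using x by linarith
    then have "x * x * (x / 4 + x * x / 16) \<le> x * x * (1/4)" using x by (intro mult_left_mono) auto
    then show "(1 - s\<^sup>2 / 2 - (s\<^sup>2)\<^sup>2 / 4)\<^sup>2 \<le> 1 - s\<^sup>2"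
      unfolding x_def[symmetric] by (simp add: power2_eq_square algebra_simps)
  qed
  have 1: "sqrt (1 - g\<^sup>2) \<le> 1 - g\<^sup>2 / 2"
    using sqrt_le_affine[of "1 - g\<^sup>2" 1] gs s9 by simp
  have 2: "sqrt (1 + s\<^sup>2 - g\<^sup>2) \<le> 1 + (s\<^sup>2 - g\<^sup>2) / 2"
    using sqrt_le_affine[of "1 + s\<^sup>2 - g\<^sup>2" 1] gs by (simp add: field_simps)
  \<comment> \<open>This is what the three estimates leave of the claim. As a function of g it is
    least at 1 / (2 n + 1), and the cases ask whether s lies below that point.\<close>
  have "s - n * s\<^sup>2 - n * (s\<^sup>2)\<^sup>2 / 4 - g + (2*n + 1) * g\<^sup>2 / 2 \<ge> 0"
  proof (cases "(2*n+1) * s \<le> 1")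
    case True
    have "(2*n+1) * (s + g) \<le> 2 * ((2*n+1) * s)" using mult_left_mono[OF g(2), of "2*n+1"] n by (simp add: algebra_simps)
    then have "(s - g) * (1 - (2*n+1) * (s + g) / 2) \<ge> 0" using True g by (intro mult_nonneg_nonneg) auto
    then have A: "s - g \<ge> (2*n+1) * s\<^sup>2 / 2 - (2*n+1) * g\<^sup>2 / 2" by (simp add: power2_eq_square field_simps)
    have "n * s \<le> 1" using True n s0 by (simp add: algebra_simps)
    then have "(n * s) * s \<le> 1 * 1" using s3 s0 n by (intro mult_mono) auto
    then have "n * s\<^sup>2 \<le> 1" by (simp add: power2_eq_square)
    then have "s\<^sup>2 * (n * s\<^sup>2) \<le> s\<^sup>2 * 1" by (intro mult_left_mono) auto
    then have B: "n * (s\<^sup>2)\<^sup>2 \<le> s\<^sup>2" by (simp add: power2_eq_square algebra_simps)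
    have "s - g \<ge> n * s\<^sup>2 + s\<^sup>2 / 2 - (2*n+1) * g\<^sup>2 / 2" using A by (simp add: field_simps)
    then show ?thesis using B zero_le_power2[of s] by linarith
  next
    case False
    define m where "m = 2*n + 1"
    have m: "m \<ge> 5" "n = (m - 1) / 2" using n by (auto simp: m_def)
    have "0 \<le> (m * g - 1)\<^sup>2 / (2 * m)" using m(1) by (intro divide_nonneg_pos) auto
    also have "\<dots> = m * g\<^sup>2 / 2 - g + 1 / (2 * m)"
      using m(1) by (simp add: power2_eq_square field_simps)
    finally have G: "m * g\<^sup>2 / 2 - g \<ge> - 1 / (2 * m)" by simp
    have sm: "m * s \<ge> 1" "(m - 2) * s \<le> 1" using False s by (auto simp: m_def)
    have "n * (s\<^sup>2)\<^sup>2 / 4 \<le> s\<^sup>2 / 16"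
    proof -
      have "(m - 1) / 2 * s \<le> 2/3 * (m - 2) * s" using m(1) s0 by (intro mult_right_mono) auto
      also have "\<dots> \<le> 2/3" using sm(2) by (simp add: algebra_simps)
      finally have "n * s \<le> 2/3" unfolding m(2) .
      then have "(n * s) * s \<le> 2/3 * (1/3)" using s3 s0 n by (intro mult_mono) auto
      then have "n * s\<^sup>2 \<le> 1/4" by (simp add: power2_eq_square)
      then have "s\<^sup>2 / 4 * (n * s\<^sup>2) \<le> s\<^sup>2 / 4 * (1/4)" by (intro mult_left_mono) auto
      then show ?thesis by (simp add: power2_eq_square algebra_simps)
    qed
    moreover have "s - n * s\<^sup>2 - s\<^sup>2 / 16 \<ge> 1 / (2 * m)"
    proof -
      \<comment> \<open>With n = (m - 1)/2 the expression to be bounded is s - (m - 7/8) s^2 / 2. As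
        s lies between 1/m and 1/(m - 2), the product being nonnegative bounds s^2 by its chord
        there.\<close>
      have "(m - 7/8) * ((m * s - 1) * (1 - (m - 2) * s)) \<ge> 0"
        using sm m(1) by (intro mult_nonneg_nonneg) auto
      moreover have "s * (m / 4 + 7/4) \<le> 9/8" using sm(2) s3 by (simp add: algebra_simps)
      ultimately have "(m - 2) * (2 * m * (s - n * s\<^sup>2 - s\<^sup>2 / 16) - 1) \<ge> 0"
        unfolding m(2) by (simp add: field_simps power2_eq_square)
      then have "2 * m * (s - n * s\<^sup>2 - s\<^sup>2 / 16) - 1 \<ge> 0"
        using m(1) by (simp add: zero_le_mult_iff)
      then show ?thesis using m(1) by (simp add: field_simps)
    qed
    ultimately show ?thesis using G unfolding m_def by linarith
  qed
  moreover have "(n+1) * sqrt (1 - g\<^sup>2) \<le> (n+1) * (1 - g\<^sup>2 / 2)" using 1 n by (intro mult_left_mono) auto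
  moreover have "n * sqrt (1 + s\<^sup>2 - g\<^sup>2) \<le> n * (1 + (s\<^sup>2 - g\<^sup>2) / 2)" using 2 n by (intro mult_left_mono) auto
  moreover have "n * sqrt (1 - s\<^sup>2) \<ge> n * (1 - s\<^sup>2 / 2 - (s\<^sup>2)\<^sup>2 / 4)" using c n by (intro mult_left_mono) auto
  ultimately show ?thesis by (simp add: field_simps)
qed


text \<open>At the critical sine \<open>s = sqrt (\<beta>\<^sup>2 - 1)\<close> an additional width of dark column costs exactly its
  width, so the right-hand side is the excess of a crossing that ends somewhere inside its last dark column.
  Completing that column and crossing one more light column is at least as good.\<close>

lemma strip_excess_Suc_le_critical:
  assumes \<beta>: "\<beta> > 1" and s: "s = sqrt (\<beta>\<^sup>2 - 1)" "s < snell_sine \<beta> k" "snell_sine \<beta> (Suc k) \<le> s"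
  shows "strip_excess \<beta> (Suc k) \<le> s - (real k + 1) * (1 - sqrt (1 - s\<^sup>2))"
proof -
  define n where "n = real k + 1"
  let ?\<sigma> = "snell_sine \<beta> k" and ?g = "snell_sine \<beta> (Suc k)"
  note S = snell_sine[OF \<beta>, of k] and S' = snell_sine[OF \<beta>, of "Suc k"]
  have \<beta>2: "\<beta>\<^sup>2 > 1" using power_strict_mono[of 1 \<beta> 2] \<beta> by simp
  have "s < 1" using s(2) S(2) by (rule less_trans)
  then have s0: "s > 0" "s < 1" "\<beta>\<^sup>2 = 1 + s\<^sup>2" using s \<beta>2 by auto
  define c where "c = sqrt (1 - s\<^sup>2)"
  have s1: "s\<^sup>2 < 1" using s0 power_strict_mono[of s 1 2] by simp
  have c: "c > 0" "c\<^sup>2 = 1 - s\<^sup>2" "c \<le> 1" using s1 by (auto simp: c_def)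
  have sq: "s\<^sup>2 < ?\<sigma>\<^sup>2" using s0(1) s(2) by (intro power_strict_mono) simp_all
  have rad: "1 - ?\<sigma>\<^sup>2 > 0" "\<beta>\<^sup>2 - ?\<sigma>\<^sup>2 > 0" by (rule snell_sine_radicands[OF \<beta>])+
  \<comment> \<open>The left side of Snell's equation grows with the sine, so at s it is at most its
    value 1 at the larger sine for k; the dark root is 1 at s because \<beta>^2 - s^2 = 1. This
    bounds s in terms of n, as the two preceding inequalities require.\<close>
  have "n * s / c + (n - 1) * s / 1 \<le> n * ?\<sigma> / sqrt (1 - ?\<sigma>\<^sup>2) + (n - 1) * ?\<sigma> / sqrt (\<beta>\<^sup>2 - ?\<sigma>\<^sup>2)"
  proof (rule add_mono)
    have "n * s \<le> n * ?\<sigma>" "(n - 1) * s \<le> (n - 1) * ?\<sigma>"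
      using s(2) by (intro mult_left_mono; simp add: n_def)+
    moreover have "0 \<le> n * ?\<sigma>" "0 \<le> (n - 1) * ?\<sigma>" using S(1) by (simp_all add: n_def)
    moreover have "sqrt (1 - ?\<sigma>\<^sup>2) \<le> c" "0 < sqrt (1 - ?\<sigma>\<^sup>2)" "sqrt (\<beta>\<^sup>2 - ?\<sigma>\<^sup>2) \<le> 1" "0 < sqrt (\<beta>\<^sup>2 - ?\<sigma>\<^sup>2)"
      using sq rad s0(3) by (simp_all add: c_def)
    ultimately show "n * s / c \<le> n * ?\<sigma> / sqrt (1 - ?\<sigma>\<^sup>2)" "(n - 1) * s / 1 \<le> (n - 1) * ?\<sigma> / sqrt (\<beta>\<^sup>2 - ?\<sigma>\<^sup>2)"
      by (auto intro!: frac_le simp only:)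
  qed
  also have "\<dots> = 1" using S(3) by (simp add: n_def)
  finally have A: "n * s / c + (n - 1) * s \<le> 1" by simp
  have g: "0 \<le> ?g" "?g \<le> s" using S'(1) s(3) by simp_all
  have "?g + (n+1) * sqrt (1 - ?g\<^sup>2) + n * sqrt (1 + s\<^sup>2 - ?g\<^sup>2) \<le> s + n * c + n + 1"
  proof (cases "k = 0")
    case True
    then have "s \<le> c" using A c by (simp add: n_def)
    then have "s\<^sup>2 \<le> c\<^sup>2" using s0 by (intro power_mono) auto
    then have "s\<^sup>2 \<le> 1/2" using c by simp
    from critical_gap_one[OF g this] show ?thesis using True by (simp add: n_def c_def)
  next
    case False
    have "n * s \<le> n * s / c" using c s0 by (simp add: n_def pos_le_divide_eq mult_left_le)
    then have "(2*n - 1) * s \<le> 1" using A by (simp add: algebra_simps)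
    from critical_gap_ge_two[OF _ g this] show ?thesis using False by (simp add: n_def c_def)
  qed
  moreover have "strip_excess \<beta> (Suc k) = ?g + (n+1) * sqrt (1 - ?g\<^sup>2) + n * sqrt (1 + s\<^sup>2 - ?g\<^sup>2) - (2 * n + 1)"
    unfolding strip_excess_def snell_gap_def s0(3) by (simp add: n_def algebra_simps)
  ultimately show ?thesis by (simp add: n_def c_def algebra_simps)
qed

text \<open>The gap is nonincreasing in p, so p = k + 1 is the worst case, and affine in q. If its
  slope in q is nonnegative at the optimal sine for k, then q = k is worst. If it is nonpositive at
  the optimal sine for k + 1, then q = k + 1 is worst, and lacking the light column number k + 2
  only raises the gap. Otherwise the critical sine makes the slope vanish.\<close>

lemma strip_crossing_bound:
  assumes \<beta>: "\<beta> > 1" and p: "0 \<le> p" "p \<le> real k + 1" and q: "real k \<le> q" "q \<le> real k + 1"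
  obtains s where "0 \<le> s" "s \<le> 1" "strip_excess \<beta> (k_c \<beta>) \<le> snell_gap \<beta> p q s"
proof -
  let ?L = "strip_excess \<beta> (k_c \<beta>)"
  note min = strip_excess_min[OF \<beta>]
  have p_mono: "snell_gap \<beta> (real k + 1) q s \<le> snell_gap \<beta> p q s" for s
    using mult_right_mono_neg[OF p(2), of "sqrt (1 - s\<^sup>2) - 1"] by (simp add: snell_gap_def)
  have \<beta>2: "\<beta>\<^sup>2 > 1" using power_strict_mono[of 1 \<beta> 2] \<beta> by simp
  consider "sqrt (\<beta>\<^sup>2 - (snell_sine \<beta> k)\<^sup>2) \<ge> 1" | "sqrt (\<beta>\<^sup>2 - (snell_sine \<beta> (Suc k))\<^sup>2) \<le> 1"
    | "sqrt (\<beta>\<^sup>2 - (snell_sine \<beta> k)\<^sup>2) < 1" "sqrt (\<beta>\<^sup>2 - (snell_sine \<beta> (Suc k))\<^sup>2) > 1"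
    by linarith
  then show thesis
  proof cases
    case 1
    let ?s = "snell_sine \<beta> k"
    have "?L \<le> snell_gap \<beta> (real k + 1) (real k) ?s" using min[of k] by (simp add: strip_excess_def)
    also have "\<dots> \<le> snell_gap \<beta> (real k + 1) q ?s"
      using mult_right_mono[OF q(1), of "sqrt (\<beta>\<^sup>2 - ?s\<^sup>2) - 1"] 1 by (simp add: snell_gap_def)
    also have "\<dots> \<le> snell_gap \<beta> p q ?s" by (rule p_mono)
    finally show thesis using that[of ?s] snell_sine[OF \<beta>, of k] by simp
  next
    case 2
    let ?s = "snell_sine \<beta> (Suc k)"
    have "?L \<le> snell_gap \<beta> (real k + 2) (real k + 1) ?s" using min[of "Suc k"] by (simp add: strip_excess_def add.commute)
    also have "\<dots> \<le> snell_gap \<beta> (real k + 1) (real k + 1) ?s"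
      by (simp add: snell_gap_def algebra_simps)
    also have "\<dots> \<le> snell_gap \<beta> (real k + 1) q ?s"
      using mult_right_mono_neg[OF q(2), of "sqrt (\<beta>\<^sup>2 - ?s\<^sup>2) - 1"] 2 by (simp add: snell_gap_def)
    also have "\<dots> \<le> snell_gap \<beta> p q ?s" by (rule p_mono)
    finally show thesis using that[of ?s] snell_sine[OF \<beta>, of "Suc k"] by simp
  next
    case 3
    define s where "s = sqrt (\<beta>\<^sup>2 - 1)"
    have "\<beta>\<^sup>2 - (snell_sine \<beta> k)\<^sup>2 < 1" "\<beta>\<^sup>2 - (snell_sine \<beta> (Suc k))\<^sup>2 > 1" using 3 by auto
    then have s: "s < snell_sine \<beta> k" "snell_sine \<beta> (Suc k) \<le> s"
      unfolding s_def using snell_sine[OF \<beta>, of k] snell_sine[OF \<beta>, of "Suc k"]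
      by (auto intro!: real_less_lsqrt real_le_rsqrt)
    have "s < 1" using s(1) snell_sine(2)[OF \<beta>, of k] by (rule less_trans)
    then have s0: "0 \<le> s" "s \<le> 1" using \<beta>2 by (simp_all add: s_def)
    have "\<beta>\<^sup>2 - s\<^sup>2 = 1" using \<beta>2 by (simp add: s_def)
    then have "snell_gap \<beta> (real k + 1) q s = s - (real k + 1) * (1 - sqrt (1 - s\<^sup>2))"
      by (simp add: snell_gap_def algebra_simps)
    also have "\<dots> \<ge> strip_excess \<beta> (Suc k)" by (rule strip_excess_Suc_le_critical[OF \<beta> s_def s])
    finally have "?L \<le> snell_gap \<beta> (real k + 1) q s" using min[of "Suc k"] by simp
    then show thesis using that[of s] s0 p_mono[of s] by simp
  qed
qed

section \<open>Lower bound\<close>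

lemma mod2r_bounds: "0 \<le> mod2r x" "mod2r x < 2"
  unfolding mod2r_def by linarith+

lemma mod2r_eq: "x = 2 * of_int \<lfloor>x / 2\<rfloor> + mod2r x"
  by (simp add: mod2r_def)

lemma mod2r_unique: "0 \<le> r \<Longrightarrow> r < 2 \<Longrightarrow> mod2r (2 * of_int i + r) = r"
proof -
  assume "0 \<le> r" "r < 2"
  then have "\<lfloor>(2 * of_int i + r) / 2\<rfloor> = i" by (simp add: floor_eq_iff)
  then show ?thesis by (simp add: mod2r_def)
qed

lemma mod2r_add_1: "mod2r (x + 1) = (if mod2r x < 1 then mod2r x + 1 else mod2r x - 1)"
proof (cases "mod2r x < 1")
  case True
  have "x + 1 = 2 * of_int \<lfloor>x / 2\<rfloor> + (mod2r x + 1)" using mod2r_eq[of x] by simp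
  then have "mod2r (x + 1) = mod2r (2 * of_int \<lfloor>x / 2\<rfloor> + (mod2r x + 1))" by (rule arg_cong)
  also have "\<dots> = mod2r x + 1" using True mod2r_bounds[of x] by (intro mod2r_unique) auto
  finally show ?thesis using True by simp
next
  case False
  have "x + 1 = 2 * of_int (\<lfloor>x / 2\<rfloor> + 1) + (mod2r x - 1)" using mod2r_eq[of x] by simp
  then have "mod2r (x + 1) = mod2r (2 * of_int (\<lfloor>x / 2\<rfloor> + 1) + (mod2r x - 1))" by (rule arg_cong)
  also have "\<dots> = mod2r x - 1" using False mod2r_bounds[of x] by (intro mod2r_unique) auto
  finally show ?thesis using False by simp
qed

lemma mod2r_minus: "mod2r (- x) = (if mod2r x = 0 then 0 else 2 - mod2r x)"
proof (cases "mod2r x = 0")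
  case True
  then have "- x = 2 * of_int (- \<lfloor>x / 2\<rfloor>) + 0" using mod2r_eq[of x] by simp
  then have "mod2r (- x) = mod2r (2 * of_int (- \<lfloor>x / 2\<rfloor>) + 0)" by (rule arg_cong)
  also have "\<dots> = 0" by (intro mod2r_unique) auto
  finally show ?thesis using True by simp
next
  case False
  have "- x = 2 * of_int (- \<lfloor>x / 2\<rfloor> - 1) + (2 - mod2r x)" using mod2r_eq[of x] by simp
  then have "mod2r (- x) = mod2r (2 * of_int (- \<lfloor>x / 2\<rfloor> - 1) + (2 - mod2r x))" by (rule arg_cong)
  also have "\<dots> = 2 - mod2r x" using False mod2r_bounds[of x] by (intro mod2r_unique) auto
  finally show ?thesis using False by simp
qed

lemma a_beta_shift_1: "a_beta \<beta> (x + 1, y + 1) = a_beta \<beta> (x, y)"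
  using mod2r_bounds[of x] mod2r_bounds[of y] by (auto simp: a_beta_def mod2r_add_1 Let_def)

text \<open>Moving a strip down by an odd height exchanges light and dark unless it also moves
  sideways; the diagonal shift reduces every strip to the bottom one.\<close>

lemma a_beta_shift: "a_beta \<beta> (x - real n, y - real n) = a_beta \<beta> (x, y)"
proof (induction n)
  case (Suc n)
  then show ?case using a_beta_shift_1[of \<beta> "x - real (Suc n)" "y - real (Suc n)"] by (simp add: algebra_simps)
qed simp

text \<open>Reflection in one axis exchanges light and dark cells, so end points below the axis are
  treated by point reflection.\<close>

lemma a_beta_minus: "a_beta \<beta> (- x, - y) = a_beta \<beta> (x, y)"
  using mod2r_bounds[of x] mod2r_bounds[of y] by (auto simp: a_beta_def mod2r_minus Let_def)

lemma a_beta_swap: "a_beta \<beta> (y, x) = a_beta \<beta> (x, y)"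
  by (auto simp: a_beta_def Let_def)

lemma a_beta_cases: "a_beta \<beta> z = 1 \<or> a_beta \<beta> z = \<beta>"
  by (simp add: a_beta_def Let_def)

lemma borel_measurable_a_beta: "a_beta \<beta> \<in> borel_measurable borel"
proof -
  have "mod2r \<in> borel_measurable borel" unfolding mod2r_def[abs_def] by measurable
  then have [measurable]: "(\<lambda>z::real \<times> real. mod2r (fst z)) \<in> borel_measurable borel"
    "(\<lambda>z::real \<times> real. mod2r (snd z)) \<in> borel_measurable borel"
    by (auto intro: measurable_compose[OF borel_measurable_continuous_onI[OF continuous_on_fst[OF continuous_on_id]]]
      measurable_compose[OF borel_measurable_continuous_onI[OF continuous_on_snd[OF continuous_on_id]]])
  show ?thesis unfolding a_beta_def[abs_def] Let_def by measurable
qed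

text \<open>Signed width of the light columns between 0 and x in the strip 0 < y < 1, where the
  columns starting at even integers are light. \<open>dark_part\<close> is its complement.\<close>

definition light_part :: "real \<Rightarrow> real" where
  "light_part x = of_int \<lfloor>x / 2\<rfloor> + min 1 (mod2r x)"

definition dark_part :: "real \<Rightarrow> real" where
  "dark_part x = of_int \<lfloor>x / 2\<rfloor> + max 0 (mod2r x - 1)"

lemma light_dark_sum: "light_part x + dark_part x = x"
  using mod2r_eq[of x] by (auto simp: light_part_def dark_part_def)

lemma light_dark_bounds:
  "of_int \<lfloor>x / 2\<rfloor> \<le> light_part x" "light_part x \<le> of_int \<lfloor>x / 2\<rfloor> + 1"
  "of_int \<lfloor>x / 2\<rfloor> \<le> dark_part x" "dark_part x \<le> of_int \<lfloor>x / 2\<rfloor> + 1"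
  using mod2r_bounds[of x] by (auto simp: light_part_def dark_part_def)

lemma light_dark_mono:
  assumes "x \<le> y" shows "light_part x \<le> light_part y" "dark_part x \<le> dark_part y"
proof -
  consider "\<lfloor>x / 2\<rfloor> = \<lfloor>y / 2\<rfloor>" | "\<lfloor>x / 2\<rfloor> + 1 \<le> \<lfloor>y / 2\<rfloor>"
    using floor_mono[of "x/2" "y/2"] assms by linarith
  then have "light_part x \<le> light_part y \<and> dark_part x \<le> dark_part y"
  proof cases
    case 1
    then have "mod2r x \<le> mod2r y" using assms by (simp add: mod2r_def)
    then show ?thesis using 1 by (auto simp: light_part_def dark_part_def)
  next
    case 2
    then have "real_of_int \<lfloor>x / 2\<rfloor> + 1 \<le> of_int \<lfloor>y / 2\<rfloor>" by linarith
    then show ?thesis using light_dark_bounds[of x] light_dark_bounds[of y] by linarith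
  qed
  then show "light_part x \<le> light_part y" "dark_part x \<le> dark_part y" by auto
qed

lemma light_dark_lipschitz:
  "\<bar>light_part x - light_part y\<bar> \<le> \<bar>x - y\<bar>" "\<bar>dark_part x - dark_part y\<bar> \<le> \<bar>x - y\<bar>"
  using light_dark_mono[of x y] light_dark_mono[of y x] light_dark_sum[of x] light_dark_sum[of y] by linarith+

lemma light_dark_shift: "light_part (x + 2 * real k) = light_part x + real k" "dark_part (x + 2 * real k) = dark_part x + real k"
proof -
  have "(x + 2 * real k) / 2 = x / 2 + of_int (int k)" by simp
  then have "\<lfloor>(x + 2 * real k) / 2\<rfloor> = \<lfloor>x / 2\<rfloor> + int k" by (simp only: floor_add_int)
  then show "light_part (x + 2 * real k) = light_part x + real k" "dark_part (x + 2 * real k) = dark_part x + real k"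
    by (simp_all add: light_part_def dark_part_def mod2r_def)
qed

text \<open>Between any two dark columns there is only one light column.\<close>

lemma light_le_dark:
  assumes "x \<le> y" "dark_part y - dark_part x < real k + 1"
  shows "light_part y - light_part x \<le> real k + 1"
proof (rule ccontr)
  assume "\<not> ?thesis"
  then have "light_part (x + 2 * real (Suc k)) < light_part y" unfolding light_dark_shift by simp
  then have "x + 2 * real (Suc k) \<le> y" using light_dark_mono(1)[of y "x + 2 * real (Suc k)"] by linarith
  then have "dark_part x + real (Suc k) \<le> dark_part y" using light_dark_mono(2) light_dark_shift(2) by metis
  then show False using assms by simp
qed

lemma light_dark_crossing:
  fixes x y :: real
  defines "p \<equiv> \<bar>light_part y - light_part x\<bar>" and "q \<equiv> \<bar>dark_part y - dark_part x\<bar>"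
  shows "p + q = \<bar>y - x\<bar>" "p \<le> real (nat \<lfloor>q\<rfloor>) + 1"
proof -
  show "p + q = \<bar>y - x\<bar>"
    using light_dark_mono[of x y] light_dark_mono[of y x] light_dark_sum[of x] light_dark_sum[of y]
    unfolding p_def q_def by linarith
  have q: "q \<ge> 0" "q < real (nat \<lfloor>q\<rfloor>) + 1" unfolding q_def by linarith+
  show "p \<le> real (nat \<lfloor>q\<rfloor>) + 1"
  proof (cases "x \<le> y")
    case True
    then show ?thesis using light_le_dark[OF True, of "nat \<lfloor>q\<rfloor>"] q light_dark_mono[OF True] unfolding p_def q_def by simp
  next
    case False
    then have yx: "y \<le> x" by simp
    have qe: "q = dark_part x - dark_part y" "p = light_part x - light_part y"
      using light_dark_mono[OF yx] unfolding p_def q_def by simp_all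
    show ?thesis using light_le_dark[OF yx, of "nat \<lfloor>q\<rfloor>"] q(2) qe by simp
  qed
qed

text \<open>Replaces the chain rule at column edges, where the width functions have corners: a local
  extremum of h at \<open>x t\<close> is one of the composition at t.\<close>

lemma local_extremum_comp_deriv:
  fixes h x :: "real \<Rightarrow> real"
  assumes D: "((\<lambda>t. h (x t)) has_real_derivative l) (at t)" and x: "isCont x t"
    and "open S" "x t \<in> S" and ex: "(\<forall>z\<in>S. h z \<le> h (x t)) \<or> (\<forall>z\<in>S. h (x t) \<le> h z)"
  shows "l = 0"
proof -
  have "\<forall>\<^sub>F s in nhds t. x s \<in> S"
    using x assms(3,4) by (intro topological_tendstoD[of x "x t"]) (auto simp: continuous_at tendsto_at_iff_tendsto_nhds isCont_def)
  then obtain d where d: "d > 0" "\<And>s. dist s t < d \<Longrightarrow> x s \<in> S"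
    unfolding eventually_nhds_metric by blast
  have *: "\<forall>s. \<bar>t - s\<bar> < d \<longrightarrow> x s \<in> S" using d(2) by (simp add: dist_real_def abs_minus_commute)
  from ex show ?thesis
  proof
    assume "\<forall>z\<in>S. h z \<le> h (x t)"
    then show ?thesis by (intro DERIV_local_max[OF D d(1)]) (use * in blast)
  next
    assume "\<forall>z\<in>S. h (x t) \<le> h z"
    then show ?thesis by (intro DERIV_local_min[OF D d(1)]) (use * in blast)
  qed
qed

lemma light_part_comp_deriv_zero:
  assumes D: "((\<lambda>t. light_part (x t)) has_real_derivative l) (at t)" and x: "isCont x t" and m: "1 < mod2r (x t)"
  shows "l = 0"
proof -
  let ?i = "\<lfloor>x t / 2\<rfloor>"
  let ?S = "{..< 2 * of_int ?i + 2 :: real}"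
  have "light_part z \<le> light_part (x t)" if "z \<in> ?S" for z
  proof -
    have "\<lfloor>z / 2\<rfloor> \<le> ?i" using that by (simp add: floor_le_iff field_simps)
    then have "light_part z \<le> of_int ?i + 1" using light_dark_bounds(2)[of z] by linarith
    then show ?thesis using m by (simp add: light_part_def)
  qed
  moreover have "x t \<in> ?S" using mod2r_eq[of "x t"] mod2r_bounds[of "x t"] by simp
  ultimately show ?thesis by (intro local_extremum_comp_deriv[OF D x, of ?S]) auto
qed

text \<open>Edges belong to the light case because the coefficient is 1 on them. Up to the right
  edge of a light column the plateau value is a maximum from the left; at the right edge itself it
  is a minimum from the right.\<close>

lemma dark_part_comp_deriv_zero:
  assumes D: "((\<lambda>t. dark_part (x t)) has_real_derivative l) (at t)" and x: "isCont x t" and m: "mod2r (x t) \<le> 1"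
  shows "l = 0"
proof (cases "mod2r (x t) < 1")
  case True
  let ?i = "\<lfloor>x t / 2\<rfloor>"
  let ?S = "{..< 2 * of_int ?i + 1 :: real}"
  have "dark_part z \<le> dark_part (x t)" if "z \<in> ?S" for z
  proof -
    have "z \<le> 2 * of_int ?i + 1" using that by simp
    then have "dark_part z \<le> dark_part (2 * of_int ?i + 1)" by (rule light_dark_mono)
    also have "\<lfloor>(2 * of_int ?i + 1 :: real) / 2\<rfloor> = ?i" by (simp add: floor_eq_iff)
    then have "dark_part (2 * of_int ?i + 1) = of_int ?i" using mod2r_unique[of 1 ?i] by (simp add: dark_part_def)
    finally show ?thesis using True by (simp add: dark_part_def)
  qed
  moreover have "x t \<in> ?S" using mod2r_eq[of "x t"] True by simp
  ultimately show ?thesis by (intro local_extremum_comp_deriv[OF D x, of ?S]) auto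
next
  case False
  then have m1: "mod2r (x t) = 1" using m by simp
  let ?i = "\<lfloor>x t / 2\<rfloor>"
  let ?S = "{(2 * of_int ?i :: real) <..}"
  have "dark_part (x t) \<le> dark_part z" if "z \<in> ?S" for z
  proof -
    have "?i \<le> \<lfloor>z / 2\<rfloor>" using that by (simp add: le_floor_iff field_simps)
    then have "of_int ?i \<le> dark_part z" using light_dark_bounds(3)[of z] by linarith
    then show ?thesis using m1 by (simp add: dark_part_def)
  qed
  moreover have "x t \<in> ?S" using mod2r_eq[of "x t"] m1 by simp
  ultimately show ?thesis by (intro local_extremum_comp_deriv[OF D x, of ?S]) auto
qed

text \<open>Cauchy-Schwarz with the vector (sqrt (R^2 - s^2), s) of length R. Its vertical component
  s is the same for R = 1 and R = \<beta>, which is Snell's law.\<close>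

lemma weighted_cauchy:
  fixes R s u v :: real
  assumes "0 \<le> s" "s \<le> R"
  shows "sqrt (R\<^sup>2 - s\<^sup>2) * \<bar>u\<bar> + s * v \<le> R * sqrt (u\<^sup>2 + v\<^sup>2)"
proof -
  have "s\<^sup>2 \<le> R\<^sup>2" using assms by (intro power_mono) auto
  then have "(sqrt (R\<^sup>2 - s\<^sup>2))\<^sup>2 + s\<^sup>2 = R\<^sup>2" by simp
  then have "sqrt ((sqrt (R\<^sup>2 - s\<^sup>2))\<^sup>2 + s\<^sup>2) = R" using assms by simp
  moreover have "(sqrt (R\<^sup>2 - s\<^sup>2) * \<bar>u\<bar> + s * v)\<^sup>2 \<le> ((sqrt (R\<^sup>2 - s\<^sup>2))\<^sup>2 + s\<^sup>2) * (\<bar>u\<bar>\<^sup>2 + v\<^sup>2)"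
    using zero_le_power2[of "sqrt (R\<^sup>2 - s\<^sup>2) * v - s * \<bar>u\<bar>"]
    by (simp only: power2_eq_square) (simp add: algebra_simps)
  then have "sqrt (R\<^sup>2 - s\<^sup>2) * \<bar>u\<bar> + s * v \<le> sqrt (((sqrt (R\<^sup>2 - s\<^sup>2))\<^sup>2 + s\<^sup>2) * (\<bar>u\<bar>\<^sup>2 + v\<^sup>2))"
    by (rule real_le_rsqrt)
  ultimately show ?thesis by (simp only: real_sqrt_mult power2_abs)
qed

text \<open>t is the first time at which f reaches \<gamma>, and s the last time before t at which f
  is at most \<alpha>.\<close>

lemma first_crossing:
  fixes f :: "real \<Rightarrow> real"
  assumes cont: "continuous_on {a..b} f" and "a \<le> b" "f a \<le> \<alpha>" "\<alpha> < \<gamma>" "\<gamma> \<le> f b"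
  obtains s t where "a \<le> s" "s < t" "t \<le> b" "f s = \<alpha>" "f t = \<gamma>" "\<And>r. s < r \<Longrightarrow> r < t \<Longrightarrow> \<alpha> < f r \<and> f r < \<gamma>"
proof -
  let ?T = "{r\<in>{a..b}. \<gamma> \<le> f r}"
  have "?T = {a..b} \<inter> f -` {\<gamma>..}" by auto
  then have "closed ?T" using continuous_closed_preimage[OF cont closed_atLeastAtMost closed_atLeast[of \<gamma>]] by simp
  moreover have "bounded ?T" by (rule bounded_subset[of "{a..b}"]) auto
  ultimately have "compact ?T" by (simp add: compact_eq_bounded_closed)
  moreover have "?T \<noteq> {}" using assms by auto
  ultimately have "\<exists>t\<in>?T. \<forall>r\<in>?T. t \<le> r" by (rule compact_attains_inf)
  then obtain t where t: "t \<in> ?T" "\<forall>r\<in>?T. t \<le> r" by (elim bexE)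
  have tab: "a \<le> t" "t \<le> b" "\<gamma> \<le> f t" using t(1) by auto
  have cont_t: "continuous_on {a..t} f" by (rule continuous_on_subset[OF cont]) (use tab in auto)
  obtain t' where "a \<le> t'" "t' \<le> t" "f t' = \<gamma>" using IVT'[of f a \<gamma> t] tab cont_t assms by auto
  moreover have "t \<le> t'" using calculation tab by (intro t(2)[rule_format]) auto
  ultimately have ft: "f t = \<gamma>" by simp
  let ?S = "{r\<in>{a..t}. f r \<le> \<alpha>}"
  have "?S = {a..t} \<inter> f -` {..\<alpha>}" by auto
  then have "closed ?S" using continuous_closed_preimage[OF cont_t closed_atLeastAtMost closed_atMost[of \<alpha>]] by simp
  moreover have "bounded ?S" by (rule bounded_subset[of "{a..t}"]) auto
  ultimately have "compact ?S" by (simp add: compact_eq_bounded_closed)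
  moreover have "?S \<noteq> {}" using assms tab by auto
  ultimately have "\<exists>s\<in>?S. \<forall>r\<in>?S. r \<le> s" by (rule compact_attains_sup)
  then obtain s where s: "s \<in> ?S" "\<forall>r\<in>?S. r \<le> s" by (elim bexE)
  have sat: "a \<le> s" "s \<le> t" "f s \<le> \<alpha>" using s(1) by auto
  have cont_s: "continuous_on {s..t} f" by (rule continuous_on_subset[OF cont_t]) (use sat in auto)
  obtain s' where "s \<le> s'" "s' \<le> t" "f s' = \<alpha>" using IVT'[of f s \<alpha> t] sat ft cont_s assms by auto
  moreover have "s' \<le> s" using calculation sat by (intro s(2)[rule_format]) auto
  ultimately have fs: "f s = \<alpha>" by simp
  have "s < t" using sat fs ft assms by (cases "s = t") auto
  show thesis
  proof (rule that[OF sat(1) \<open>s < t\<close> tab(2) fs ft])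
    fix r assume r: "s < r" "r < t"
    have "r \<notin> ?T" using t(2) r by (meson not_le)
    moreover have "r \<notin> ?S" using s(2) r by (meson not_le)
    ultimately show "\<alpha> < f r \<and> f r < \<gamma>" using r sat tab by auto
  qed
qed

section \<open>Cost of absolutely continuous curves at scale 1\<close>

locale ac_curve =
  fixes x y Dx Dy :: "real \<Rightarrow> real" and N :: "real set"
  assumes acont_x: "acont x" and acont_y: "acont y"
    and const_x: "\<And>t. t \<le> 0 \<Longrightarrow> x t = x 0" and const_y: "\<And>t. t \<le> 0 \<Longrightarrow> y t = y 0"
    and Dx: "\<And>a b. a \<le> b \<Longrightarrow> (Dx has_integral (x b - x a)) {a..b}"
    and Dy: "\<And>a b. a \<le> b \<Longrightarrow> (Dy has_integral (y b - y a)) {a..b}"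
    and abs_int: "\<And>a b. Dx absolutely_integrable_on {a..b}" "\<And>a b. Dy absolutely_integrable_on {a..b}"
    and neg: "negligible N"
    and deriv: "\<And>t. t \<notin> N \<Longrightarrow> (x has_real_derivative Dx t) (at t)" "\<And>t. t \<notin> N \<Longrightarrow> (y has_real_derivative Dy t) (at t)"
begin

definition cost :: "real \<Rightarrow> real \<Rightarrow> real" where
  "cost \<beta> t = a_beta \<beta> (x t, y t) * norm (Dx t, Dy t)"

lemma ac_curve_shift: "ac_curve (\<lambda>t. x t - c) (\<lambda>t. y t - d) Dx Dy N"
proof
  show "acont (\<lambda>t. x t - c)" by (rule acont_dominated[OF acont_x]) simp
  show "acont (\<lambda>t. y t - d)" by (rule acont_dominated[OF acont_y]) simp
  show "x t - c = x 0 - c" "y t - d = y 0 - d" if "t \<le> 0" for t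
    using const_x[OF that] const_y[OF that] by simp_all
  show "((\<lambda>t. x t - c) has_real_derivative Dx t) (at t)" "((\<lambda>t. y t - d) has_real_derivative Dy t) (at t)" if "t \<notin> N" for t
    using deriv[OF that] by (auto intro!: derivative_eq_intros)
qed (use Dx Dy abs_int neg in auto)

lemma ac_curve_minus: "ac_curve (\<lambda>t. - x t) (\<lambda>t. - y t) (\<lambda>t. - Dx t) (\<lambda>t. - Dy t) N"
proof
  show "acont (\<lambda>t. - x t)" by (rule acont_dominated[OF acont_x]) simp
  show "acont (\<lambda>t. - y t)" by (rule acont_dominated[OF acont_y]) simp
  show "- x t = - x 0" "- y t = - y 0" if "t \<le> 0" for t using const_x[OF that] const_y[OF that] by simp_all
  show "((\<lambda>t. - x t) has_real_derivative - Dx t) (at t)" "((\<lambda>t. - y t) has_real_derivative - Dy t) (at t)" if "t \<notin> N" for t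
    using deriv[OF that] by (auto intro: DERIV_minus)
  show "((\<lambda>t. - Dx t) has_integral - x b - - x a) {a..b}" "((\<lambda>t. - Dy t) has_integral - y b - - y a) {a..b}" if "a \<le> b" for a b
    using has_integral_neg[OF Dx[OF that]] has_integral_neg[OF Dy[OF that]] by simp_all
  show "(\<lambda>t. - Dx t) absolutely_integrable_on {a..b}" "(\<lambda>t. - Dy t) absolutely_integrable_on {a..b}" for a b
    using abs_int[of a b] by (simp_all add: set_integrable_def)
qed (use neg in auto)

lemma ac_curve_swap: "ac_curve y x Dy Dx N"
  by unfold_locales (use acont_x acont_y Dx Dy abs_int neg deriv const_x const_y in blast)+

lemma continuous_xy: "continuous_on S x" "continuous_on S y"
  using acont_continuous[OF acont_x] acont_continuous[OF acont_y] by (auto intro: continuous_on_subset)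

text \<open>A bounded Borel coefficient along a continuous curve, times an absolutely integrable
  speed.\<close>

lemma cost_absolutely_integrable: "cost \<beta> absolutely_integrable_on {a..b}"
proof -
  have "(\<lambda>t. (x t, y t)) \<in> borel_measurable borel"
    by (intro borel_measurable_continuous_onI continuous_intros continuous_xy)
  then have "(\<lambda>t. a_beta \<beta> (x t, y t)) \<in> borel_measurable borel"
    by (rule measurable_compose[OF _ borel_measurable_a_beta])
  then have m: "(\<lambda>t. a_beta \<beta> (x t, y t)) \<in> borel_measurable (lebesgue_on {a..b})"
    by (simp add: measurable_completion measurable_restrict_space1)
  have bd: "bounded ((\<lambda>t. a_beta \<beta> (x t, y t)) ` {a..b})"
    by (rule bounded_subset[of "{1, \<beta>}"]) (use a_beta_cases in auto)
  have [measurable]: "Dx \<in> borel_measurable (lebesgue_on {a..b})" "Dy \<in> borel_measurable (lebesgue_on {a..b})"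
    using abs_int by (auto intro!: absolutely_integrable_imp_borel_measurable)
  have "(\<lambda>t. norm (Dx t, Dy t)) absolutely_integrable_on {a..b}"
  proof (rule measurable_bounded_by_integrable_imp_absolutely_integrable)
    show "(\<lambda>t. norm (Dx t, Dy t)) \<in> borel_measurable (lebesgue_on {a..b})" unfolding norm_Pair by measurable
    show "(\<lambda>t. \<bar>Dx t\<bar> + \<bar>Dy t\<bar>) integrable_on {a..b}"
      using abs_int by (intro integrable_add) (auto simp: absolutely_integrable_on_def)
    show "norm (norm (Dx t, Dy t)) \<le> \<bar>Dx t\<bar> + \<bar>Dy t\<bar>" for t
      by (simp add: norm_Pair sqrt_sum_squares_le_sum_abs)
  qed auto
  from absolutely_integrable_bounded_measurable_product_real[OF m _ bd this]
  show ?thesis unfolding cost_def[abs_def] by simp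
qed

lemma cost_integrable: "cost \<beta> integrable_on {a..b}"
  using cost_absolutely_integrable set_lebesgue_integral_eq_integral(1) by blast

lemma cost_ge: "\<beta> > 1 \<Longrightarrow> \<bar>Dx t\<bar> \<le> cost \<beta> t"
proof -
  assume "\<beta> > 1"
  have "\<bar>Dx t\<bar> \<le> norm (Dx t, Dy t)" by (simp add: norm_Pair)
  also have "\<dots> \<le> cost \<beta> t"
    using a_beta_cases[of \<beta> "(x t, y t)"] \<open>\<beta> > 1\<close> mult_right_mono[of 1 \<beta> "norm (Dx t, Dy t)"] by (auto simp: cost_def)
  finally show ?thesis .
qed

lemma cost_ge_displacement:
  assumes "\<beta> > 1" "s \<le> t" shows "\<bar>x t - x s\<bar> \<le> integral {s..t} (cost \<beta>)"
proof -
  have "\<bar>integral {s..t} Dx\<bar> \<le> integral {s..t} (cost \<beta>)"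
    using integral_norm_bound_integral[of Dx "{s..t}" "cost \<beta>"] Dx[OF assms(2)] cost_integrable cost_ge[OF assms(1)]
    by (auto simp: has_integral_integrable)
  then show ?thesis using integral_unique[OF Dx[OF assms(2)]] by simp
qed

text \<open>At each such time only one of the two widths moves: in a dark column l = 0, elsewhere d
  = 0. The other rate is then all of \<open>Dx t\<close>, and Cauchy-Schwarz applies with R =
  \<beta> or R = 1.\<close>

lemma cost_pointwise:
  assumes \<beta>: "\<beta> > 1" and t: "t \<notin> N" and y: "0 < y t" "y t < 1" and s: "0 \<le> s" "s \<le> 1"
    and f: "((\<lambda>t. light_part (x t)) has_real_derivative l) (at t)"
    and g: "((\<lambda>t. dark_part (x t)) has_real_derivative d) (at t)"
  shows "sqrt (1 - s\<^sup>2) * \<bar>l\<bar> + sqrt (\<beta>\<^sup>2 - s\<^sup>2) * \<bar>d\<bar> + s * Dy t \<le> cost \<beta> t"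
proof -
  have "((\<lambda>t. light_part (x t) + dark_part (x t)) has_real_derivative l + d) (at t)"
    by (intro DERIV_add f g)
  then have "(x has_real_derivative l + d) (at t)" by (simp add: light_dark_sum)
  then have ld: "Dx t = l + d" using DERIV_unique deriv(1)[OF t] by blast
  have cx: "isCont x t" using deriv(1)[OF t] by (rule DERIV_isCont)
  have my: "mod2r (y t) = y t" using mod2r_unique[of "y t" 0] y by simp
  show ?thesis
  proof (cases "1 < mod2r (x t)")
    case True
    then have "a_beta \<beta> (x t, y t) = \<beta>" using my y mod2r_bounds[of "x t"] by (simp add: a_beta_def Let_def)
    moreover have "l = 0" by (rule light_part_comp_deriv_zero[OF f cx True])
    ultimately show ?thesis using weighted_cauchy[of s \<beta> d "Dy t"] s \<beta> ld by (simp add: cost_def norm_Pair)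
  next
    case False
    then have "a_beta \<beta> (x t, y t) = 1" using my y by (simp add: a_beta_def Let_def)
    moreover have "d = 0" using False by (intro dark_part_comp_deriv_zero[OF g cx]) simp
    ultimately show ?thesis using weighted_cauchy[of s 1 l "Dy t"] s ld by (simp add: cost_def norm_Pair)
  qed
qed

lemma strip_cost:
  assumes \<beta>: "\<beta> > 1" and st: "s \<le> t" and y: "y s = 0" "y t = 1" "\<And>r. s < r \<Longrightarrow> r < t \<Longrightarrow> 0 < y r \<and> y r < 1"
  shows "\<bar>x t - x s\<bar> + strip_excess \<beta> (k_c \<beta>) \<le> integral {s..t} (cost \<beta>)"
proof -
  have acf: "acont (\<lambda>t. light_part (x t))" and acg: "acont (\<lambda>t. dark_part (x t))"
    by (rule acont_dominated[OF acont_x]; simp add: light_dark_lipschitz)+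
  have const_f: "light_part (x t) = light_part (x 0)" and const_g: "dark_part (x t) = dark_part (x 0)" if "t \<le> 0" for t
    using const_x[OF that] by (rule arg_cong)+
  obtain Df Nf where f: "\<And>a b. a \<le> b \<Longrightarrow> (Df has_integral (light_part (x b) - light_part (x a))) {a..b}"
    "\<And>a b. Df absolutely_integrable_on {a..b}" "negligible Nf"
    "\<And>t. t \<notin> Nf \<Longrightarrow> ((\<lambda>t. light_part (x t)) has_real_derivative Df t) (at t)"
    using acont_real_derivative[OF acf const_f] by blast
  obtain Dg Ng where g: "\<And>a b. a \<le> b \<Longrightarrow> (Dg has_integral (dark_part (x b) - dark_part (x a))) {a..b}"
    "\<And>a b. Dg absolutely_integrable_on {a..b}" "negligible Ng"
    "\<And>t. t \<notin> Ng \<Longrightarrow> ((\<lambda>t. dark_part (x t)) has_real_derivative Dg t) (at t)"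
    using acont_real_derivative[OF acg const_g] by blast
  define p q where "p = \<bar>light_part (x t) - light_part (x s)\<bar>" and "q = \<bar>dark_part (x t) - dark_part (x s)\<bar>"
  have pq: "p + q = \<bar>x t - x s\<bar>" "p \<le> real (nat \<lfloor>q\<rfloor>) + 1"
    unfolding p_def q_def by (rule light_dark_crossing)+
  have q: "real (nat \<lfloor>q\<rfloor>) \<le> q" "q \<le> real (nat \<lfloor>q\<rfloor>) + 1" unfolding q_def by linarith+
  have p0: "0 \<le> p" by (simp add: p_def)
  obtain \<sigma> where \<sigma>: "0 \<le> \<sigma>" "\<sigma> \<le> 1" "strip_excess \<beta> (k_c \<beta>) \<le> snell_gap \<beta> p q \<sigma>"
    by (rule strip_crossing_bound[OF \<beta> p0 pq(2) q])
  let ?A = "sqrt (1 - \<sigma>\<^sup>2)" and ?B = "sqrt (\<beta>\<^sup>2 - \<sigma>\<^sup>2)"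
  have "\<sigma>\<^sup>2 \<le> 1" "\<sigma>\<^sup>2 \<le> \<beta>\<^sup>2" using \<sigma> \<beta> power_mono[of \<sigma> 1 2] power_mono[of \<sigma> \<beta> 2] by auto
  then have AB: "?A \<ge> 0" "?B \<ge> 0" by simp_all
  let ?h = "\<lambda>r. ?A * \<bar>Df r\<bar> + ?B * \<bar>Dg r\<bar> + \<sigma> * Dy r"
  have int: "(\<lambda>r. \<bar>Df r\<bar>) integrable_on {s..t}" "(\<lambda>r. \<bar>Dg r\<bar>) integrable_on {s..t}" "Dy integrable_on {s..t}"
    using f(2) g(2) Dy[OF st] by (auto simp: absolutely_integrable_on_def)
  \<comment> \<open>Backtracking only helps: the net widths p and q are at most the total
    variations, and their weights are nonnegative.\<close>
  have "p \<le> integral {s..t} (\<lambda>r. \<bar>Df r\<bar>)" "q \<le> integral {s..t} (\<lambda>r. \<bar>Dg r\<bar>)"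
    using integral_norm_bound_integral[of Df "{s..t}" "\<lambda>r. \<bar>Df r\<bar>"] integral_norm_bound_integral[of Dg "{s..t}" "\<lambda>r. \<bar>Dg r\<bar>"]
      f(1)[OF st] g(1)[OF st] int integral_unique[OF f(1)[OF st]] integral_unique[OF g(1)[OF st]]
    by (auto simp: p_def q_def has_integral_integrable)
  then have "?A * p + ?B * q + \<sigma> * 1 \<le> ?A * integral {s..t} (\<lambda>r. \<bar>Df r\<bar>) + ?B * integral {s..t} (\<lambda>r. \<bar>Dg r\<bar>) + \<sigma> * integral {s..t} Dy"
    using AB \<sigma>(1) y(1,2) integral_unique[OF Dy[OF st]] by (intro add_mono mult_left_mono) auto
  also have "\<dots> = integral {s..t} ?h"
    using int by (intro integral_unique[symmetric] has_integral_add has_integral_mult_right integrable_integral)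
  also have "\<dots> \<le> integral {s..t} (cost \<beta>)"
  proof -
    \<comment> \<open>The cost is altered on a null set so that the comparison holds at every point.
      The times s and t are included because y is strictly between 0 and 1 only in between.\<close>
    let ?N = "N \<union> Nf \<union> Ng \<union> {s, t}"
    let ?c = "\<lambda>r. if r \<in> ?N then ?h r else cost \<beta> r"
    have N: "negligible ?N" using neg f(3) g(3) by (simp add: negligible_Un)
    have hint: "?h integrable_on {s..t}" using int by (intro integrable_add integrable_on_mult_right) auto
    have cint: "?c integrable_on {s..t}" by (rule integrable_spike[OF cost_integrable N]) auto
    have "integral {s..t} ?h \<le> integral {s..t} ?c"
    proof (rule integral_le[OF hint cint])
      fix r assume r: "r \<in> {s..t}"
      show "?h r \<le> ?c r"
      proof (cases "r \<in> ?N")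
        case False
        then have "r \<notin> N" "r \<notin> Nf" "r \<notin> Ng" "s < r" "r < t" using r by auto
        then show ?thesis
          using cost_pointwise[OF \<beta> \<open>r \<notin> N\<close> _ _ \<sigma>(1,2) f(4)[OF \<open>r \<notin> Nf\<close>] g(4)[OF \<open>r \<notin> Ng\<close>]] y(3)[of r] by simp
      qed simp
    qed
    also have "\<dots> = integral {s..t} (cost \<beta>)" by (rule integral_spike[OF N]) auto
    finally show ?thesis .
  qed
  finally show ?thesis using \<sigma>(3) pq(1) unfolding snell_gap_def by (simp add: algebra_simps)
qed

end

text \<open>The cut is at a crossing of the last strip: the induction hypothesis covers the time
  before it, \<open>strip_cost\<close> the crossing, and horizontal displacement the time after
  it.\<close>

lemma (in ac_curve) strips_cost:
  assumes \<beta>: "\<beta> > 1" and y0: "y 0 = 0"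
  shows "0 \<le> t \<Longrightarrow> y t = real n \<Longrightarrow> \<bar>x t - x 0\<bar> + real n * strip_excess \<beta> (k_c \<beta>) \<le> integral {0..t} (cost \<beta>)"
proof (induction n arbitrary: t)
  case 0
  then show ?case using cost_ge_displacement[OF \<beta>, of 0 t] by simp
next
  case (Suc n)
  let ?L = "strip_excess \<beta> (k_c \<beta>)"
  obtain s r where sr: "0 \<le> s" "s < r" "r \<le> t" "y s = real n" "y r = real (Suc n)"
    "\<And>r'. s < r' \<Longrightarrow> r' < r \<Longrightarrow> real n < y r' \<and> y r' < real (Suc n)"
    by (rule first_crossing[OF continuous_xy(2)[of "{0..t}"], of "real n" "real (Suc n)"]) (use Suc.prems y0 in auto)
  interpret sh: ac_curve "\<lambda>t. x t - real n" "\<lambda>t. y t - real n" Dx Dy N by (rule ac_curve_shift)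
  have "sh.cost \<beta> = cost \<beta>" by (simp add: fun_eq_iff sh.cost_def cost_def a_beta_shift)
  then have "\<bar>x r - x s\<bar> + ?L \<le> integral {s..r} (cost \<beta>)"
    using sh.strip_cost[OF \<beta>, of s r] sr by fastforce
  moreover have "\<bar>x s - x 0\<bar> + real n * ?L \<le> integral {0..s} (cost \<beta>)" by (rule Suc.IH[OF sr(1,4)])
  moreover have "\<bar>x t - x r\<bar> \<le> integral {r..t} (cost \<beta>)" by (rule cost_ge_displacement[OF \<beta> sr(3)])
  moreover have "integral {0..s} (cost \<beta>) + integral {s..t} (cost \<beta>) = integral {0..t} (cost \<beta>)"
    using sr by (intro Henstock_Kurzweil_Integration.integral_combine cost_integrable) auto
  moreover have "integral {s..r} (cost \<beta>) + integral {r..t} (cost \<beta>) = integral {s..t} (cost \<beta>)"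
    using sr by (intro Henstock_Kurzweil_Integration.integral_combine cost_integrable) auto
  ultimately show ?case by (simp add: algebra_simps)
qed

text \<open>Only the complete strips below the end point are counted; the missing fraction of a
  strip accounts for the error term.\<close>

lemma (in ac_curve) total_cost:
  assumes \<beta>: "\<beta> > 1" and start: "x 0 = 0" "y 0 = 0" and y1: "y 1 \<ge> 0"
  shows "\<bar>x 1\<bar> + strip_excess \<beta> (k_c \<beta>) * y 1 - \<bar>strip_excess \<beta> (k_c \<beta>)\<bar> \<le> integral {0..1} (cost \<beta>)"
proof -
  let ?L = "strip_excess \<beta> (k_c \<beta>)"
  define n where "n = nat \<lfloor>y 1\<rfloor>"
  have n: "real n \<le> y 1" "y 1 < real n + 1" using y1 unfolding n_def by linarith+
  obtain t where t: "0 \<le> t" "t \<le> 1" "y t = real n"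
    using IVT'[of y 0 "real n" 1] start n continuous_xy(2)[of "{0..1}"] by auto
  have "\<bar>x t\<bar> + real n * ?L \<le> integral {0..t} (cost \<beta>)"
    using strips_cost[OF \<beta> start(2) t(1,3)] start by simp
  moreover have "\<bar>x 1 - x t\<bar> \<le> integral {t..1} (cost \<beta>)" by (rule cost_ge_displacement[OF \<beta> t(2)])
  moreover have "integral {0..t} (cost \<beta>) + integral {t..1} (cost \<beta>) = integral {0..1} (cost \<beta>)"
    using t by (intro Henstock_Kurzweil_Integration.integral_combine cost_integrable) auto
  moreover have "?L * y 1 - \<bar>?L\<bar> \<le> real n * ?L"
  proof -
    have "?L * (y 1 - real n) \<le> \<bar>?L\<bar> * (y 1 - real n)" using n by (intro mult_right_mono) auto
    also have "\<dots> \<le> \<bar>?L\<bar>" using n by (intro mult_left_le) auto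
    finally show ?thesis by (simp add: algebra_simps)
  qed
  ultimately show ?thesis by linarith
qed

lemma (in ac_curve) total_cost_abs:
  assumes \<beta>: "\<beta> > 1" and start: "x 0 = 0" "y 0 = 0"
  shows "\<bar>x 1\<bar> + strip_excess \<beta> (k_c \<beta>) * \<bar>y 1\<bar> - \<bar>strip_excess \<beta> (k_c \<beta>)\<bar> \<le> integral {0..1} (cost \<beta>)"
proof (cases "y 1 \<ge> 0")
  case True
  then show ?thesis using total_cost[OF \<beta> start] by simp
next
  case False
  interpret m: ac_curve "\<lambda>t. - x t" "\<lambda>t. - y t" "\<lambda>t. - Dx t" "\<lambda>t. - Dy t" N by (rule ac_curve_minus)
  have "m.cost \<beta> = cost \<beta>" by (simp add: fun_eq_iff m.cost_def cost_def a_beta_minus norm_Pair)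
  then show ?thesis using m.total_cost[OF \<beta>] start False by simp
qed

lemma (in ac_curve) total_cost_swap:
  assumes \<beta>: "\<beta> > 1" and start: "x 0 = 0" "y 0 = 0"
  shows "\<bar>y 1\<bar> + strip_excess \<beta> (k_c \<beta>) * \<bar>x 1\<bar> - \<bar>strip_excess \<beta> (k_c \<beta>)\<bar> \<le> integral {0..1} (cost \<beta>)"
proof -
  interpret w: ac_curve y x Dy Dx N by (rule ac_curve_swap)
  have "w.cost \<beta> = cost \<beta>" by (simp add: fun_eq_iff w.cost_def cost_def a_beta_swap norm_Pair add.commute)
  then show ?thesis using w.total_cost_abs[OF \<beta> start(2,1)] by simp
qed

text \<open>Dividing by \<epsilon> moves the curve to scale 1. The factor \<epsilon> in the length
  comes from the speed, the coefficient being already evaluated at u / \<epsilon>.\<close>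

lemma ac_curve_of_abs_cont:
  fixes u :: "real \<Rightarrow> real \<times> real"
  assumes u: "abs_cont_on 0 1 u" and \<epsilon>: "\<epsilon> > 0"
  obtains x y Dx Dy N where "ac_curve x y Dx Dy N"
    "\<And>t. t \<in> {0..1} \<Longrightarrow> u t = (\<epsilon> * x t, \<epsilon> * y t)"
    "wlength \<beta> \<epsilon> u = \<epsilon> * integral {0..1} (ac_curve.cost x y Dx Dy \<beta>)"
proof -
  define U where "U = (\<lambda>t. u (max 0 (min 1 t)))"
  have U: "acont U" unfolding U_def by (rule abs_cont_on_imp_acont_clamp[OF u])
  define x y where "x = (\<lambda>t. fst (U t))" and "y = (\<lambda>t. snd (U t))"
  have acx: "acont x" and acy: "acont y"
  proof -
    have "norm (fst z) \<le> norm z" "norm (snd z) \<le> norm z" for z :: "real \<times> real"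
      by (metis norm_fst_le prod.collapse) (metis norm_snd_le prod.collapse)
    then have "norm (x t - x s) \<le> norm (U t - U s)" "norm (y t - y s) \<le> norm (U t - U s)" for s t
      unfolding x_def y_def fst_diff[symmetric] snd_diff[symmetric] by blast+
    then show "acont x" "acont y" using acont_dominated[OF U] by blast+
  qed
  have const: "x t = x 0" "y t = y 0" if "t \<le> 0" for t using that by (auto simp: x_def y_def U_def max_def min_def)
  obtain Dx Nx where X: "\<And>a b. a \<le> b \<Longrightarrow> (Dx has_integral (x b - x a)) {a..b}"
    "\<And>a b. Dx absolutely_integrable_on {a..b}" "negligible Nx" "\<And>t. t \<notin> Nx \<Longrightarrow> (x has_real_derivative Dx t) (at t)"
    using acont_real_derivative[OF acx const(1)] by blast
  obtain Dy Ny where Y: "\<And>a b. a \<le> b \<Longrightarrow> (Dy has_integral (y b - y a)) {a..b}"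
    "\<And>a b. Dy absolutely_integrable_on {a..b}" "negligible Ny" "\<And>t. t \<notin> Ny \<Longrightarrow> (y has_real_derivative Dy t) (at t)"
    using acont_real_derivative[OF acy const(2)] by blast
  let ?x = "\<lambda>t. x t / \<epsilon>" and ?y = "\<lambda>t. y t / \<epsilon>" and ?Dx = "\<lambda>t. Dx t / \<epsilon>" and ?Dy = "\<lambda>t. Dy t / \<epsilon>"
  \<comment> \<open>For \<epsilon> < 1 the increments grow, so domination by f fails and the modulus
    is taken for e \<epsilon>.\<close>
  have scale: "acont (\<lambda>t. f t / \<epsilon>)" if f: "acont f" for f :: "real \<Rightarrow> real"
  proof (rule acontI)
    fix e :: real assume "e > 0"
    then have "e * \<epsilon> > 0" using \<epsilon> by simp
    then obtain d where d: "d > 0" "ac_modulus f (e * \<epsilon>) d" using acontE[OF f] by blast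
    show "\<exists>d>0. \<forall>I l r. disjoint_ivls I l r \<longrightarrow> (\<Sum>i\<in>I. r i - l i) < d \<longrightarrow> (\<Sum>i\<in>I. norm (f (r i) / \<epsilon> - f (l i) / \<epsilon>)) < e"
    proof (intro exI[of _ d] conjI allI impI d(1))
      fix I l r assume a: "disjoint_ivls I l r" "(\<Sum>i\<in>I. r i - l i) < d"
      have "(\<Sum>i\<in>I. norm (f (r i) / \<epsilon> - f (l i) / \<epsilon>)) = (\<Sum>i\<in>I. norm (f (r i) - f (l i))) / \<epsilon>"
        using \<epsilon> by (simp add: sum_divide_distrib flip: diff_divide_distrib)
      also have "\<dots> < e" using ac_modulusD[OF d(2) a] \<epsilon> by (simp add: pos_divide_less_eq)
      finally show "(\<Sum>i\<in>I. norm (f (r i) / \<epsilon> - f (l i) / \<epsilon>)) < e" .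
    qed
  qed
  interpret C: ac_curve ?x ?y ?Dx ?Dy "Nx \<union> Ny"
  proof
    show "acont ?x" "acont ?y" by (rule scale acx acy)+
    show "?x t = ?x 0" "?y t = ?y 0" if "t \<le> 0" for t using const[OF that] by simp_all
    show "(?Dx has_integral ?x b - ?x a) {a..b}" "(?Dy has_integral ?y b - ?y a) {a..b}" if "a \<le> b" for a b
      using has_integral_divide[OF X(1)[OF that], of \<epsilon>] has_integral_divide[OF Y(1)[OF that], of \<epsilon>] by (simp_all add: diff_divide_distrib)
    show "?Dx absolutely_integrable_on {a..b}" "?Dy absolutely_integrable_on {a..b}" for a b
      using X(2) Y(2) by (auto intro!: set_integrable_divide)
    show "negligible (Nx \<union> Ny)" using X Y by simp
    show "(?x has_real_derivative ?Dx t) (at t)" "(?y has_real_derivative ?Dy t) (at t)" if "t \<notin> Nx \<union> Ny" for t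
      using X(4)[of t] Y(4)[of t] that by (auto intro!: DERIV_cdivide)
  qed
  have ut: "u t = (x t, y t)" if "t \<in> {0..1}" for t using that by (simp add: x_def y_def U_def)
  show thesis
  proof (rule that[OF C.ac_curve_axioms])
    show "u t = (\<epsilon> * (x t / \<epsilon>), \<epsilon> * (y t / \<epsilon>))" if "t \<in> {0..1}" for t using ut[OF that] \<epsilon> by simp
    have "wlength \<beta> \<epsilon> u = integral {0..1} (\<lambda>t. \<epsilon> * C.cost \<beta> t)"
      unfolding wlength_def
    proof (rule integral_spike[of "Nx \<union> Ny \<union> {0, 1}"])
      \<comment> \<open>The times 0 and 1 are exceptional because u agrees with its clamped
        extension only on [0,1], so two-sided derivatives there may differ.\<close>
      show "negligible (Nx \<union> Ny \<union> {0, 1})" using X Y by (simp add: negligible_Un)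
      fix t assume t: "t \<in> {0..1} - (Nx \<union> Ny \<union> {0, 1})"
      then have "(x has_vector_derivative Dx t) (at t)" "(y has_vector_derivative Dy t) (at t)"
        using X(4)[of t] Y(4)[of t] by (auto simp: has_real_derivative_iff_has_vector_derivative)
      then have "((\<lambda>t. (x t, y t)) has_vector_derivative (Dx t, Dy t)) (at t)"
        by (rule has_vector_derivative_Pair)
      then have "(u has_vector_derivative (Dx t, Dy t)) (at t)"
        by (rule has_vector_derivative_transform_within_open[of _ _ _ "{0<..<1}"]) (use t ut in auto)
      then have "vector_derivative u (at t) = (Dx t, Dy t)" by (rule vector_derivative_at)
      moreover have "norm (Dx t / \<epsilon>, Dy t / \<epsilon>) = norm (Dx t, Dy t) / \<epsilon>"
        using norm_scaleR[of "1/\<epsilon>" "(Dx t, Dy t)"] \<epsilon> by simp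
      moreover have "(1 / \<epsilon>) *\<^sub>R u t = (x t / \<epsilon>, y t / \<epsilon>)" using t ut[of t] by simp
      ultimately show "\<epsilon> * C.cost \<beta> t = a_beta \<beta> ((1 / \<epsilon>) *\<^sub>R u t) * norm (vector_derivative u (at t))"
        using \<epsilon> by (simp add: C.cost_def)
    qed
    also have "\<dots> = \<epsilon> * integral {0..1} (C.cost \<beta>)" by simp
    finally show "wlength \<beta> \<epsilon> u = \<epsilon> * integral {0..1} (C.cost \<beta>)" .
  qed
qed

lemma wlength_lower_bound:
  assumes \<beta>: "\<beta> > 1" and \<epsilon>: "\<epsilon> > 0" and u: "abs_cont_on 0 1 u" "u 0 = (0, 0)" "u 1 = (a, b)"
  defines "L \<equiv> strip_excess \<beta> (k_c \<beta>)"
  shows "\<bar>a\<bar> + L * \<bar>b\<bar> - \<epsilon> * \<bar>L\<bar> \<le> wlength \<beta> \<epsilon> u" "\<bar>b\<bar> + L * \<bar>a\<bar> - \<epsilon> * \<bar>L\<bar> \<le> wlength \<beta> \<epsilon> u"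
proof -
  obtain x y Dx Dy N where C: "ac_curve x y Dx Dy N"
    and ut: "\<And>t. t \<in> {0..1} \<Longrightarrow> u t = (\<epsilon> * x t, \<epsilon> * y t)"
    and w: "wlength \<beta> \<epsilon> u = \<epsilon> * integral {0..1} (ac_curve.cost x y Dx Dy \<beta>)"
    using ac_curve_of_abs_cont[OF u(1) \<epsilon>, of \<beta> thesis] by blast
  have start: "x 0 = 0" "y 0 = 0" and e: "x 1 = a / \<epsilon>" "y 1 = b / \<epsilon>"
    using ut[of 0] ut[of 1] u \<epsilon> by auto
  have "\<epsilon> * (\<bar>a / \<epsilon>\<bar> + L * \<bar>b / \<epsilon>\<bar> - \<bar>L\<bar>) \<le> wlength \<beta> \<epsilon> u"
    using mult_left_mono[OF ac_curve.total_cost_abs[OF C \<beta> start], of \<epsilon>] \<epsilon> by (simp add: w e L_def)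
  then show "\<bar>a\<bar> + L * \<bar>b\<bar> - \<epsilon> * \<bar>L\<bar> \<le> wlength \<beta> \<epsilon> u"
    using \<epsilon> by (simp add: right_diff_distrib distrib_left abs_divide)
  have "\<epsilon> * (\<bar>b / \<epsilon>\<bar> + L * \<bar>a / \<epsilon>\<bar> - \<bar>L\<bar>) \<le> wlength \<beta> \<epsilon> u"
    using mult_left_mono[OF ac_curve.total_cost_swap[OF C \<beta> start], of \<epsilon>] \<epsilon> by (simp add: w e L_def)
  then show "\<bar>b\<bar> + L * \<bar>a\<bar> - \<epsilon> * \<bar>L\<bar> \<le> wlength \<beta> \<epsilon> u"
    using \<epsilon> by (simp add: right_diff_distrib distrib_left abs_divide)
qed

section \<open>Upper bound\<close>

text \<open>The derivative \<open>v'\<close> is explicit because \<open>vector_derivative\<close> is an arbitrary value at the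
  corners of a polygon, which need not be compatible with scaling and reflection.\<close>

definition reach :: "real \<Rightarrow> real \<times> real \<Rightarrow> real \<Rightarrow> bool" where
  "reach \<beta> \<xi> c \<longleftrightarrow> (\<exists>n v v' S K. n \<ge> (1::nat) \<and> v 0 = (0, 0) \<and> v (real n) = \<xi> \<and>
     K-lipschitz_on {0..real n} v \<and> finite S \<and>
     (\<forall>t\<in>{0<..<real n} - S. (v has_vector_derivative v' t) (at t)) \<and>
     ((\<lambda>t. a_beta \<beta> (v t) * norm (v' t)) has_integral c) {0..real n})"

lemma reachI:
  assumes "n \<ge> (1::nat)" "v 0 = (0, 0)" "v (real n) = \<xi>" "K-lipschitz_on {0..real n} v" "finite S"
    "\<forall>t\<in>{0<..<real n} - S. (v has_vector_derivative v' t) (at t)"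
    "((\<lambda>t. a_beta \<beta> (v t) * norm (v' t)) has_integral c) {0..real n}"
  shows "reach \<beta> \<xi> c"
  unfolding reach_def using assms by (intro exI conjI)

lemma reachE:
  assumes "reach \<beta> \<xi> c"
  obtains n v v' S K where "n \<ge> (1::nat)" "v 0 = (0, 0)" "v (real n) = \<xi>" "K-lipschitz_on {0..real n} v" "finite S"
    "\<forall>t\<in>{0<..<real n} - S. (v has_vector_derivative v' t) (at t)"
    "((\<lambda>t. a_beta \<beta> (v t) * norm (v' t)) has_integral c) {0..real n}"
  using assms unfolding reach_def by blast

lemma reach_0: "reach \<beta> (0, 0) 0"
  by (rule reachI[of 1 "\<lambda>_. (0,0)" _ 0 "{}" "\<lambda>_. (0,0)"])
     (auto simp: lipschitz_on_def zero_prod_def[symmetric])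

text \<open>The new segment takes one further unit of time. The coefficient has to be constant only
  on its open interior, so both ends may lie on cell boundaries.\<close>

lemma reach_segment:
  assumes "reach \<beta> \<xi> c" and b: "\<And>\<tau>. 0 < \<tau> \<Longrightarrow> \<tau> < 1 \<Longrightarrow> a_beta \<beta> (\<xi> + \<tau> *\<^sub>R (\<eta> - \<xi>)) = b"
  shows "reach \<beta> \<eta> (c + b * norm (\<eta> - \<xi>))"
proof -
  obtain n v v' S K where v: "n \<ge> (1::nat)" "v 0 = (0, 0)" "v (real n) = \<xi>" "K-lipschitz_on {0..real n} v" "finite S"
    "\<forall>t\<in>{0<..<real n} - S. (v has_vector_derivative v' t) (at t)"
    "((\<lambda>t. a_beta \<beta> (v t) * norm (v' t)) has_integral c) {0..real n}"
    using assms(1) by (rule reachE)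
  define N where "N = real n"
  have N: "N \<ge> 1" "real (Suc n) = N + 1" using v(1) by (auto simp: N_def)
  define l where "l = (\<lambda>t. \<xi> + (t - N) *\<^sub>R (\<eta> - \<xi>))"
  define w where "w = (\<lambda>t. if t \<le> N then v t else l t)"
  define w' where "w' = (\<lambda>t. if t \<le> N then v' t else \<eta> - \<xi>)"
  have lip: "(norm (\<eta> - \<xi>))-lipschitz_on {N..N+1} l"
    by (rule lipschitz_onI) (auto simp: l_def dist_norm mult.commute simp flip: scaleR_diff_left)
  have "v N = l N" using v(3) by (simp add: l_def N_def)
  then have lipw: "(max K (norm (\<eta> - \<xi>)))-lipschitz_on {0..N+1} w"
    unfolding w_def using lipschitz_on_concat_max[OF v(4)[folded N_def] lip] by blast
  have dw: "(w has_vector_derivative w' t) (at t)" if t: "t \<in> {0<..<N+1} - (insert N S)" for t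
  proof (cases "t < N")
    case True
    then have "(v has_vector_derivative v' t) (at t)" using t by (intro v(6)[rule_format]) (auto simp: N_def)
    then have "(w has_vector_derivative v' t) (at t)"
      by (rule has_vector_derivative_transform_within_open[of _ _ _ "{..<N}"]) (use True in \<open>auto simp: w_def\<close>)
    then show ?thesis using True by (simp add: w'_def)
  next
    case False
    have "(l has_vector_derivative (\<eta> - \<xi>)) (at t)"
      unfolding l_def by (auto intro!: derivative_eq_intros)
    then have "(w has_vector_derivative (\<eta> - \<xi>)) (at t)"
      by (rule has_vector_derivative_transform_within_open[of _ _ _ "{N<..}"]) (use False t in \<open>auto simp: w_def\<close>)
    then show ?thesis using False t by (auto simp: w'_def)
  qed
  have i1: "((\<lambda>t. a_beta \<beta> (w t) * norm (w' t)) has_integral c) {0..N}"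
    using v(7)[folded N_def] by (rule has_integral_eq[rotated]) (auto simp: w_def w'_def N_def)
  have "((\<lambda>t. b * norm (\<eta> - \<xi>)) has_integral b * norm (\<eta> - \<xi>)) {N..N+1}"
    using has_integral_const_real[of "b * norm (\<eta> - \<xi>)" N "N+1"] by simp
  then have i2: "((\<lambda>t. a_beta \<beta> (w t) * norm (w' t)) has_integral b * norm (\<eta> - \<xi>)) {N..N+1}"
  proof (rule has_integral_spike_finite[of "{N, N+1}", rotated 2])
    fix t assume "t \<in> {N..N+1} - {N, N+1}"
    then show "a_beta \<beta> (w t) * norm (w' t) = b * norm (\<eta> - \<xi>)"
      using b[of "t - N"] by (auto simp: w_def w'_def l_def)
  qed simp
  have int: "((\<lambda>t. a_beta \<beta> (w t) * norm (w' t)) has_integral c + b * norm (\<eta> - \<xi>)) {0..N+1}"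
    by (rule has_integral_combine[OF _ _ i1 i2]) (use N in auto)
  show ?thesis
    by (rule reachI[of "Suc n" w \<eta> _ "insert N S" w'], unfold N(2))
       (use lipw dw int N v(2,5) in \<open>auto simp: w_def l_def\<close>)
qed

lemma reach_swap: "reach \<beta> (x, y) c \<Longrightarrow> reach \<beta> (y, x) c"
proof -
  assume "reach \<beta> (x, y) c"
  then obtain n v v' S K where v: "n \<ge> (1::nat)" "v 0 = (0, 0)" "v (real n) = (x, y)" "K-lipschitz_on {0..real n} v" "finite S"
    "\<forall>t\<in>{0<..<real n} - S. (v has_vector_derivative v' t) (at t)"
    "((\<lambda>t. a_beta \<beta> (v t) * norm (v' t)) has_integral c) {0..real n}"
    by (rule reachE)
  have d: "dist (prod.swap p) (prod.swap q) = dist p q" for p q :: "real \<times> real"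
    by (simp add: dist_prod_def add.commute)
  have bl: "bounded_linear (prod.swap :: real \<times> real \<Rightarrow> _)"
    unfolding prod.swap_def by (intro bounded_linear_Pair bounded_linear_fst bounded_linear_snd)
  have a: "a_beta \<beta> (prod.swap p) = a_beta \<beta> p" "norm (prod.swap p) = norm p" for p :: "real \<times> real"
    using a_beta_swap[of \<beta> "snd p" "fst p"] by (simp_all add: prod.swap_def norm_prod_def add.commute)
  show ?thesis
    by (rule reachI[of n "\<lambda>t. prod.swap (v t)" _ K S "\<lambda>t. prod.swap (v' t)"])
       (use v bounded_linear.has_vector_derivative[OF bl] in \<open>auto simp: a lipschitz_on_def d\<close>)
qed

lemma reach_minus: "reach \<beta> (x, y) c \<Longrightarrow> reach \<beta> (- x, - y) c"
proof -
  assume "reach \<beta> (x, y) c"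
  then obtain n v v' S K where v: "n \<ge> (1::nat)" "v 0 = (0, 0)" "v (real n) = (x, y)" "K-lipschitz_on {0..real n} v" "finite S"
    "\<forall>t\<in>{0<..<real n} - S. (v has_vector_derivative v' t) (at t)"
    "((\<lambda>t. a_beta \<beta> (v t) * norm (v' t)) has_integral c) {0..real n}"
    by (rule reachE)
  have a: "a_beta \<beta> (- p) = a_beta \<beta> p" for p :: "real \<times> real"
    using a_beta_minus[of \<beta> "fst p" "snd p"] by (simp add: uminus_prod_def)
  show ?thesis
    by (rule reachI[of n "\<lambda>t. - v t" _ K S "\<lambda>t. - v' t"])
       (use v in \<open>auto simp: a lipschitz_on_def dist_minus intro!: has_vector_derivative_minus\<close>)
qed

lemma lipschitz_imp_abs_cont_on:
  assumes "K-lipschitz_on {a..b} u" shows "abs_cont_on a b u"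
  unfolding abs_cont_on_def
proof (intro allI impI)
  fix e :: real assume "e > 0"
  have K: "K \<ge> 0" using assms by (rule lipschitz_on_nonneg)
  show "\<exists>d>0. \<forall>n (l::nat \<Rightarrow> real) r.
        (\<forall>i<n. a \<le> l i \<and> l i < r i \<and> r i \<le> b) \<and>
        (\<forall>i<n. \<forall>j<n. i \<noteq> j \<longrightarrow> r i \<le> l j \<or> r j \<le> l i) \<and>
        (\<Sum>i<n. r i - l i) < d
        \<longrightarrow> (\<Sum>i<n. norm (u (r i) - u (l i))) < e"
  proof (rule exI[of _ "e / (K + 1)"], intro conjI allI impI, goal_cases)
    case 1 then show ?case using \<open>e > 0\<close> K by simp
  next
    case (2 n l r)
    have "(\<Sum>i<n. norm (u (r i) - u (l i))) \<le> (\<Sum>i<n. K * (r i - l i))"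
    proof (rule sum_mono)
      fix i assume "i \<in> {..<n}"
      then have "a \<le> l i" "l i < r i" "r i \<le> b" using 2 by blast+
      then show "norm (u (r i) - u (l i)) \<le> K * (r i - l i)"
        using lipschitz_onD[OF assms, of "r i" "l i"] by (simp add: dist_norm)
    qed
    also have "\<dots> = K * (\<Sum>i<n. r i - l i)" by (simp add: sum_distrib_left)
    also have "(\<Sum>i<n. r i - l i) < e / (K + 1)" using 2 by blast
    then have "K * (\<Sum>i<n. r i - l i) \<le> K * (e / (K + 1))" using K by (intro mult_left_mono) auto
    also have "\<dots> < e" using K \<open>e > 0\<close> by (simp add: field_simps)
    finally show ?case .
  qed
qed

text \<open>Time is compressed from [0, n] to [0, 1] and space scaled by \<epsilon>; the finitely
  many corners, where \<open>vector_derivative\<close> is uncontrolled, do not affect the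
  integral.\<close>

lemma reach_imp_curve:
  assumes "reach \<beta> \<xi> c" and \<epsilon>: "\<epsilon> > 0"
  obtains u where "abs_cont_on 0 1 u" "u 0 = (0, 0)" "u 1 = \<epsilon> *\<^sub>R \<xi>" "wlength \<beta> \<epsilon> u = \<epsilon> * c"
proof -
  obtain n v v' S K where v: "n \<ge> (1::nat)" "v 0 = (0, 0)" "v (real n) = \<xi>" "K-lipschitz_on {0..real n} v" "finite S"
    "\<forall>t\<in>{0<..<real n} - S. (v has_vector_derivative v' t) (at t)"
    "((\<lambda>t. a_beta \<beta> (v t) * norm (v' t)) has_integral c) {0..real n}"
    using assms(1) by (rule reachE)
  define N where "N = real n"
  have N: "N > 0" using v(1) by (simp add: N_def)
  define u where "u = (\<lambda>t. \<epsilon> *\<^sub>R v (N * t))"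
  have "(\<epsilon> * K * N)-lipschitz_on {0..1} u"
  proof (rule lipschitz_onI)
    fix s t :: real assume st: "s \<in> {0..1}" "t \<in> {0..1}"
    have "dist (v (N * s)) (v (N * t)) \<le> K * dist (N * s) (N * t)"
      using st N by (intro lipschitz_onD[OF v(4)]) (auto simp: N_def[symmetric] mult_left_le)
    also have "dist (N * s) (N * t) = N * dist s t" using N by (simp add: dist_real_def abs_mult flip: right_diff_distrib)
    finally have "\<epsilon> * dist (v (N * s)) (v (N * t)) \<le> \<epsilon> * (K * (N * dist s t))" using \<epsilon> by simp
    then show "dist (u s) (u t) \<le> \<epsilon> * K * N * dist s t" using \<epsilon> by (simp add: u_def dist_norm mult.assoc flip: scaleR_diff_right)
  qed (use \<epsilon> N lipschitz_on_nonneg[OF v(4)] in simp)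
  then have ac: "abs_cont_on 0 1 u" by (rule lipschitz_imp_abs_cont_on)
  have img: "(\<lambda>x. x / N) ` {0..N} = {0..1}"
    using N image_affinity_atLeastAtMost_div[of N 0 0 N] by simp
  have "((\<lambda>t. a_beta \<beta> (v (N * t)) * norm (v' (N * t))) has_integral c / N) {0..1}"
    using has_integral_stretch_real[OF v(7), of N] N img by (simp add: N_def[symmetric])
  from has_integral_mult_right[OF this, of "\<epsilon> * N"]
  have i: "((\<lambda>t. \<epsilon> * N * (a_beta \<beta> (v (N * t)) * norm (v' (N * t)))) has_integral \<epsilon> * c) {0..1}"
    using N by simp
  have "((\<lambda>t. a_beta \<beta> ((1 / \<epsilon>) *\<^sub>R u t) * norm (vector_derivative u (at t))) has_integral \<epsilon> * c) {0..1}"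
  proof (rule has_integral_spike_finite[OF _ _ i])
    show "finite ({0, 1} \<union> (\<lambda>x. x / N) ` S)" using v(5) by simp
    fix t assume t: "t \<in> {0..1} - ({0, 1} \<union> (\<lambda>x. x / N) ` S)"
    then have "0 < N * t" "N * t < N" "N * t \<notin> S" using N by (auto simp: image_iff)
    then have "(v has_vector_derivative v' (N * t)) (at (N * t))" by (intro v(6)[rule_format]) (auto simp: N_def)
    moreover have "((\<lambda>t. N * t) has_real_derivative N) (at t)" by (auto intro!: derivative_eq_intros)
    ultimately have "((\<lambda>t. v (N * t)) has_vector_derivative N *\<^sub>R v' (N * t)) (at t)"
      using vector_diff_chain_at[of "\<lambda>t. N * t" N t v "v' (N * t)"]
      by (simp add: o_def has_real_derivative_iff_has_vector_derivative)
    then have "(u has_vector_derivative \<epsilon> *\<^sub>R N *\<^sub>R v' (N * t)) (at t)"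
      unfolding u_def by (rule bounded_linear.has_vector_derivative[OF bounded_linear_scaleR_right])
    then have "vector_derivative u (at t) = \<epsilon> *\<^sub>R N *\<^sub>R v' (N * t)" by (rule vector_derivative_at)
    then show "a_beta \<beta> ((1 / \<epsilon>) *\<^sub>R u t) * norm (vector_derivative u (at t)) = \<epsilon> * N * (a_beta \<beta> (v (N * t)) * norm (v' (N * t)))"
      using \<epsilon> N by (simp add: u_def)
  qed
  then have "wlength \<beta> \<epsilon> u = \<epsilon> * c" unfolding wlength_def by (rule integral_unique)
  then show thesis using that[OF ac] v(2,3) by (simp add: u_def N_def zero_prod_def[symmetric])
qed

section \<open>Refracted polygons on the chessboard\<close>

lemma mod2r_int: "mod2r (of_int i) = (if even i then 0 else 1)"
proof (cases "even i")
  case True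
  then obtain j where "i = 2 * j" by blast
  then show ?thesis using mod2r_unique[of 0 j] by simp
next
  case False
  then obtain j where "i = 2 * j + 1" by (rule oddE)
  then show ?thesis using mod2r_unique[of 1 j] by simp
qed

lemma mod2r_open_cell: "of_int i < x \<Longrightarrow> x < of_int i + 1 \<Longrightarrow> mod2r x = x - of_int i + (if even i then 0 else 1)"
proof -
  assume x: "of_int i < x" "x < of_int i + 1"
  show ?thesis
  proof (cases "even i")
    case True
    then obtain j where "i = 2 * j" by blast
    then show ?thesis using mod2r_unique[of "x - of_int i" j] x by simp
  next
    case False
    then obtain j where "i = 2 * j + 1" by (rule oddE)
    then show ?thesis using mod2r_unique[of "x - of_int i + 1" j] x by simp
  qed
qed

lemma a_beta_cell:
  assumes "of_int i < x" "x < of_int i + 1" "of_int j < y" "y < of_int j + 1"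
  shows "a_beta \<beta> (x, y) = (if even (i + j) then 1 else \<beta>)"
  using assms by (auto simp: a_beta_def Let_def mod2r_open_cell)

text \<open>The dark cells are open, so grid lines have coefficient 1 throughout.\<close>

lemma a_beta_horizontal: "a_beta \<beta> (x, of_int j) = 1"
  by (auto simp: a_beta_def Let_def mod2r_int)

lemma a_beta_vertical:
  assumes "of_int j < y" "y < of_int j + 1" "of_int j < z" "z < of_int j + 1"
  shows "a_beta \<beta> (x, y) = a_beta \<beta> (x, z)"
  using assms by (auto simp: a_beta_def Let_def mod2r_open_cell)

lemma reach_horizontal:
  assumes "reach \<beta> (x, of_int j) c" shows "reach \<beta> (x', of_int j) (c + \<bar>x' - x\<bar>)"
  using reach_segment[OF assms, of "(x', of_int j)" 1] by (simp add: a_beta_horizontal norm_Pair)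

text \<open>Closes the remaining height below 1; the crude bound \<beta> suffices since it becomes
  \<epsilon> \<beta> after scaling.\<close>

lemma reach_vertical:
  assumes "reach \<beta> (x, of_int j) c" "\<beta> > 1" "of_int j \<le> y" "y < of_int j + 1"
  obtains c' where "reach \<beta> (x, y) c'" "c' \<le> c + \<beta>"
proof -
  have "a_beta \<beta> (x, of_int j + \<tau> * (y - of_int j)) = a_beta \<beta> (x, of_int j + 1/2)"
    if "0 < \<tau>" "\<tau> < 1" "of_int j < y" for \<tau>
  proof (rule a_beta_vertical)
    have "\<tau> * (y - of_int j) < 1 * 1" using that assms by (intro mult_strict_mono) auto
    then show "of_int j + \<tau> * (y - of_int j) < of_int j + 1" by simp
  qed (use that in auto)
  then have r: "reach \<beta> (x, y) (c + a_beta \<beta> (x, of_int j + 1/2) * \<bar>y - of_int j\<bar>)" if "of_int j < y"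
    using reach_segment[OF assms(1), of "(x, y)"] that by (simp add: norm_Pair)
  have "a_beta \<beta> (x, of_int j + 1/2) * \<bar>y - of_int j\<bar> \<le> \<beta> * 1"
    using a_beta_cases[of \<beta> "(x, of_int j + 1/2)"] assms by (intro mult_mono) auto
  then show thesis using r that assms by (cases "of_int j < y") auto
qed

text \<open>e is the horizontal direction and i the column traversed, which lies left of X when e =
  -1; the parity of i + n tells light from dark.\<close>

lemma reach_across_cell:
  fixes X n :: int and e h h' :: real
  assumes r: "reach \<beta> (of_int X, of_int n + h) c" and e: "e = 1 \<and> i = X \<or> e = -1 \<and> i = X - 1"
    and h: "0 \<le> h" "h < h'" "h' \<le> 1"
  shows "reach \<beta> (of_int X + e, of_int n + h') (c + (if even (i + n) then 1 else \<beta>) * sqrt (1 + (h' - h)\<^sup>2))"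
proof -
  let ?\<xi> = "(of_int X :: real, of_int n + h)" and ?\<eta> = "(of_int X + e, of_int n + h')"
  have "a_beta \<beta> (?\<xi> + \<tau> *\<^sub>R (?\<eta> - ?\<xi>)) = (if even (i + n) then 1 else \<beta>)" if \<tau>: "0 < \<tau>" "\<tau> < 1" for \<tau>
  proof -
    have eq: "?\<xi> + \<tau> *\<^sub>R (?\<eta> - ?\<xi>) = (of_int X + \<tau> * e, of_int n + (h + \<tau> * (h' - h)))"
      by (simp add: algebra_simps)
    have pos: "0 < \<tau> * (h' - h)" using \<tau> h by simp
    have "\<tau> * (h' - h) < h' - h" using \<tau> h by simp
    also have "\<dots> \<le> 1 - h" using h by simp
    finally have "h + \<tau> * (h' - h) < 1" by simp
    moreover have "0 < h + \<tau> * (h' - h)" using h(1) pos by (rule add_nonneg_pos)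
    ultimately show ?thesis unfolding eq using e \<tau> by (intro a_beta_cell) auto
  qed
  from reach_segment[OF r this] show ?thesis using e by (auto simp: norm_Pair)
qed

context
  fixes \<beta> :: real and k :: nat
  assumes \<beta>: "\<beta> > 1"
begin

text \<open>Tangents of the refraction angles, whose sines are \<sigma> in light and \<sigma> /
  \<beta> in dark cells. Snell's equation says that k + 1 light and k dark cells then climb exactly
  1.\<close>

definition "light_slope = snell_sine \<beta> k / sqrt (1 - (snell_sine \<beta> k)\<^sup>2)"
definition "dark_slope = snell_sine \<beta> k / sqrt (\<beta>\<^sup>2 - (snell_sine \<beta> k)\<^sup>2)"

lemma slopes:
  "light_slope > 0" "dark_slope > 0"
  "real (k + 1) * light_slope + real k * dark_slope = 1"
  "real (k + 1) * sqrt (1 + light_slope\<^sup>2) + real k * (\<beta> * sqrt (1 + dark_slope\<^sup>2)) = strip_excess \<beta> k + 2 * real k + 1"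
proof -
  define s where "s = snell_sine \<beta> k"
  note S = snell_sine[OF \<beta>, of k, folded s_def] and R = snell_sine_radicands[OF \<beta>, of k, folded s_def]
  define a b where "a = sqrt (1 - s\<^sup>2)" and "b = sqrt (\<beta>\<^sup>2 - s\<^sup>2)"
  have ab: "a > 0" "b > 0" "a\<^sup>2 = 1 - s\<^sup>2" "b\<^sup>2 = \<beta>\<^sup>2 - s\<^sup>2" using R by (auto simp: a_def b_def)
  have sl: "light_slope = s / a" "dark_slope = s / b" by (simp_all add: light_slope_def dark_slope_def a_def b_def s_def)
  show "light_slope > 0" "dark_slope > 0" using S ab by (simp_all add: sl)
  show "real (k + 1) * light_slope + real k * dark_slope = 1" using S(3) by (simp add: sl a_def b_def add.commute)
  have "1 + (s / a)\<^sup>2 = (1 / a)\<^sup>2" "1 + (s / b)\<^sup>2 = (\<beta> / b)\<^sup>2" using ab by (simp_all add: field_simps)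
  then have "sqrt (1 + light_slope\<^sup>2) = 1 / a" "sqrt (1 + dark_slope\<^sup>2) = \<beta> / b" using ab \<beta> by (simp_all add: sl)
  moreover have "lf (2 * real k) \<beta> = (real k + 1) / a + \<beta>\<^sup>2 * real k / b - 2 * real k - sqrt 2"
    by (simp add: lf_def Let_def pf_qf_even a_def b_def s_def snell_sine_def)
  moreover have "real (k + 1) * (1 / a) + real k * (\<beta> * (\<beta> / b)) = (real k + 1) / a + \<beta>\<^sup>2 * real k / b"
    by (simp add: power2_eq_square mult_ac)
  ultimately show "real (k + 1) * sqrt (1 + light_slope\<^sup>2) + real k * (\<beta> * sqrt (1 + dark_slope\<^sup>2)) = strip_excess \<beta> k + 2 * real k + 1"
    using lf_even[OF \<beta>, of k] by simp
qed

text \<open>Light and dark cells alternate, starting with light, so among the first j cells (j + 1)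
  div 2 are light and j div 2 dark. Going right the first column is X, going left it is X - 1; hence
  the opposite parities in \<open>e\<close>.\<close>

lemma reach_strip_partial:
  fixes X n :: int and e :: real
  assumes r: "reach \<beta> (of_int X, of_int n) c" and e: "e = 1 \<and> even (X + n) \<or> e = -1 \<and> odd (X + n)"
  shows "j \<le> 2 * k + 1 \<Longrightarrow> reach \<beta> (of_int X + e * real j, of_int n + (real ((j + 1) div 2) * light_slope + real (j div 2) * dark_slope))
    (c + (real ((j + 1) div 2) * sqrt (1 + light_slope\<^sup>2) + real (j div 2) * (\<beta> * sqrt (1 + dark_slope\<^sup>2))))"
proof (induction j)
  case 0 then show ?case using r by simp
next
  case (Suc j)
  let ?h = "\<lambda>j. real ((j + 1) div 2) * light_slope + real (j div 2) * dark_slope"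
  have mono: "?h i \<le> ?h j" if "i \<le> j" for i j
    using that slopes(1,2) by (intro add_mono mult_right_mono) (auto intro!: div_le_mono)
  \<comment> \<open>The path stays in the strip because the heights increase to exactly 1.\<close>
  have "?h (Suc j) \<le> ?h (2 * k + 1)" by (rule mono) (use Suc.prems in simp)
  also have "?h (2 * k + 1) = 1" using slopes(3) by simp
  finally have h1: "?h (Suc j) \<le> 1" .
  have h0: "0 \<le> ?h j" using slopes(1,2) by simp
  define X' where "X' = X + (if e = 1 then int j else - int j)"
  have X': "of_int X' = of_int X + e * real j" using e by (auto simp: X'_def)
  define i where "i = (if e = 1 then X' else X' - 1)"
  have ei: "e = 1 \<and> i = X' \<or> e = -1 \<and> i = X' - 1" using e by (auto simp: i_def)
  have par: "even (i + n) \<longleftrightarrow> even j" using e by (auto simp: i_def X'_def)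
  have IH: "reach \<beta> (of_int X', of_int n + ?h j) (c + (real ((j + 1) div 2) * sqrt (1 + light_slope\<^sup>2) + real (j div 2) * (\<beta> * sqrt (1 + dark_slope\<^sup>2))))"
    unfolding X' using Suc by simp
  have Xe: "of_int X' + e = of_int X + e * real (Suc j)" by (simp add: X' algebra_simps)
  show ?case
  proof (cases "even j")
    case True
    then obtain m where m: "j = 2 * m" by blast
    have "?h (Suc j) - ?h j = light_slope" by (simp add: m algebra_simps)
    then show ?thesis
      using reach_across_cell[OF IH ei h0 _ h1] slopes(1) par True unfolding Xe by (simp add: m algebra_simps)
  next
    case False
    then obtain m where m: "j = 2 * m + 1" by (rule oddE)
    have "?h (Suc j) - ?h j = dark_slope" by (simp add: m algebra_simps)
    then show ?thesis
      using reach_across_cell[OF IH ei h0 _ h1] slopes(2) par False unfolding Xe by (simp add: m algebra_simps)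
  qed
qed

lemma reach_strip:
  fixes X n :: int and e :: int
  assumes r: "reach \<beta> (of_int X, of_int n) c" and e: "e = 1 \<and> even (X + n) \<or> e = -1 \<and> odd (X + n)"
  shows "reach \<beta> (of_int (X + e * (2 * int k + 1)), of_int (n + 1)) (c + (strip_excess \<beta> k + 2 * real k + 1))"
  using reach_strip_partial[OF r, of "of_int e" "2 * k + 1"] e slopes(3,4) by (auto simp: algebra_simps)

text \<open>The cell to the left of the origin in the bottom strip is dark. Going left, the path
  therefore first moves to (1, 0), which is the offset \<open>o'\<close> and costs 1.\<close>

lemma reach_strips:
  fixes e :: int
  assumes e: "e = 1 \<and> o' = 0 \<or> e = -1 \<and> o' = (1::int)"
  shows "reach \<beta> (of_int (o' + e * (2 * int k + 1) * int n), of_int (int n)) (of_int o' + real n * (strip_excess \<beta> k + 2 * real k + 1))"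
proof (induction n)
  case 0
  have "reach \<beta> (0, of_int 0) 0" using reach_0 by simp
  from reach_horizontal[OF this, of "of_int o'"] show ?case using e by auto
next
  case (Suc n)
  have "e = 1 \<and> even (o' + e * (2 * int k + 1) * int n + int n) \<or> e = -1 \<and> odd (o' + e * (2 * int k + 1) * int n + int n)"
    using e by auto
  from reach_strip[OF Suc this] show ?case by (simp add: algebra_simps)
qed

text \<open>By the cone condition the climb does not overshoot a by more than the offset, so its
  horizontal length W cancels against the remaining distance. In the error,
  \<open>\<bar>strip_excess \<beta> k\<bar>\<close> pays for the incomplete strip, 2 for the offset
  and its effect on the remaining distance, and \<beta> for the final vertical piece.\<close>

lemma reach_cone:
  assumes b: "b \<ge> 0" and cone: "(2 * real k + 1) * b \<le> \<bar>a\<bar>"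
  obtains c where "reach \<beta> (a, b) c" "c \<le> \<bar>a\<bar> + strip_excess \<beta> k * b + (\<bar>strip_excess \<beta> k\<bar> + 2 + \<beta>)"
proof -
  let ?L = "strip_excess \<beta> k"
  define n where "n = nat \<lfloor>b\<rfloor>"
  have n: "real n \<le> b" "b < real n + 1" using b unfolding n_def by linarith+
  define e :: int where "e = (if a \<ge> 0 then 1 else -1)"
  define o' :: int where "o' = (if a \<ge> 0 then 0 else 1)"
  have e: "e = 1 \<and> o' = 0 \<or> e = -1 \<and> o' = 1" by (simp add: e_def o'_def)
  define X :: real where "X = of_int (o' + e * (2 * int k + 1) * int n)"
  define W where "W = (2 * real k + 1) * real n"
  have "W \<le> (2 * real k + 1) * b" unfolding W_def using n by (intro mult_left_mono) auto
  then have W: "W \<le> \<bar>a\<bar>" using cone by simp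
  have X: "X = of_int o' + of_int e * W" by (simp add: X_def W_def algebra_simps)
  have d: "\<bar>a - X\<bar> \<le> \<bar>a\<bar> - W + 1" unfolding X using W by (auto simp: e_def o'_def)
  from reach_horizontal[OF reach_strips[OF e, of n], of a]
  have r: "reach \<beta> (a, of_int (int n)) (of_int o' + real n * (?L + 2 * real k + 1) + \<bar>a - X\<bar>)" by (simp only: X_def)
  obtain c where c: "reach \<beta> (a, b) c" "c \<le> of_int o' + real n * (?L + 2 * real k + 1) + \<bar>a - X\<bar> + \<beta>"
    by (rule reach_vertical[OF r \<beta>, of b]) (use n in auto)
  have "real n * ?L \<le> ?L * b + \<bar>?L\<bar>"
  proof -
    have "(- ?L) * (b - real n) \<le> \<bar>?L\<bar> * (b - real n)" using n by (intro mult_right_mono) auto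
    also have "\<dots> \<le> \<bar>?L\<bar>" using n by (intro mult_left_le) auto
    finally show ?thesis by (simp add: algebra_simps)
  qed
  moreover have "real n * (?L + 2 * real k + 1) = real n * ?L + W" by (simp add: W_def algebra_simps)
  moreover have "(of_int o' :: real) \<le> 1" by (simp add: o'_def)
  ultimately have "c \<le> \<bar>a\<bar> + ?L * b + (\<bar>?L\<bar> + 2 + \<beta>)" using c(2) d by linarith
  then show thesis using that c(1) by blast
qed

lemma reach_cone_abs:
  assumes cone: "(2 * real k + 1) * \<bar>b\<bar> \<le> \<bar>a\<bar>"
  obtains c where "reach \<beta> (a, b) c" "c \<le> \<bar>a\<bar> + strip_excess \<beta> k * \<bar>b\<bar> + (\<bar>strip_excess \<beta> k\<bar> + 2 + \<beta>)"
proof (cases "b \<ge> 0")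
  case True
  then show thesis using reach_cone[of b a] cone that by auto
next
  case False
  then obtain c where c: "reach \<beta> (- a, - b) c" "c \<le> \<bar>- a\<bar> + strip_excess \<beta> k * (- b) + (\<bar>strip_excess \<beta> k\<bar> + 2 + \<beta>)"
    using reach_cone[of "- b" "- a"] cone by auto
  show thesis using that[of c] reach_minus[OF c(1)] c(2) False by simp
qed

end

section \<open>Passage to the limit\<close>

lemma Phi_eqI:
  assumes "\<And>\<epsilon>. \<epsilon> > 0 \<Longrightarrow> \<bar>d_eps \<beta> \<epsilon> \<xi> - v\<bar> \<le> C * \<epsilon>"
  shows "Phi \<beta> \<xi> = v"
proof -
  have "((\<lambda>\<epsilon>. d_eps \<beta> \<epsilon> \<xi> - v) \<longlongrightarrow> 0) (at_right 0)"
  proof (rule Lim_null_comparison)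
    show "\<forall>\<^sub>F \<epsilon> in at_right 0. norm (d_eps \<beta> \<epsilon> \<xi> - v) \<le> C * \<epsilon>"
      using assms by (auto simp: eventually_at_filter)
    show "((\<lambda>\<epsilon>. C * \<epsilon>) \<longlongrightarrow> 0) (at_right 0)"
      by (rule tendsto_eq_intros | simp)+
  qed
  then have "((\<lambda>\<epsilon>. d_eps \<beta> \<epsilon> \<xi>) \<longlongrightarrow> v) (at_right 0)" by (simp add: LIM_zero_iff)
  then show ?thesis unfolding Phi_def by (intro tendsto_Lim) (auto simp: trivial_limit_at_right_real)
qed

theorem theorem6p4:
  fixes \<beta> x y :: real
  assumes "\<beta> > 1"
    and "(2 * real (k_c \<beta>) + 1) * \<bar>y\<bar> \<le> \<bar>x\<bar> \<or> (2 * real (k_c \<beta>) + 1) * \<bar>x\<bar> \<le> \<bar>y\<bar>"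
  shows "Phi \<beta> (x, y) = max \<bar>x\<bar> \<bar>y\<bar> + (lf (2 * real (k_c \<beta>)) \<beta> + sqrt 2 - 1) * min \<bar>x\<bar> \<bar>y\<bar>"
proof -
  note \<beta> = assms(1)
  define L where "L = strip_excess \<beta> (k_c \<beta>)"
  define v where "v = max \<bar>x\<bar> \<bar>y\<bar> + L * min \<bar>x\<bar> \<bar>y\<bar>"
  have "Phi \<beta> (x, y) = v"
  proof (rule Phi_eqI)
    fix \<epsilon> :: real assume \<epsilon>: "\<epsilon> > 0"
    let ?W = "{wlength \<beta> \<epsilon> u | u. abs_cont_on 0 1 u \<and> u 0 = (0, 0) \<and> u 1 = (x, y)}"
    have lower: "v - \<epsilon> * \<bar>L\<bar> \<le> w" if w: "w \<in> ?W" for w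
    proof -
      obtain u where "w = wlength \<beta> \<epsilon> u" "abs_cont_on 0 1 u" "u 0 = (0, 0)" "u 1 = (x, y)" using w by blast
      \<comment> \<open>Of the two lower bounds the one whose leading term is the larger coordinate
        gives v.\<close>
      then show ?thesis
        using wlength_lower_bound[OF \<beta> \<epsilon>, of u x y] unfolding v_def L_def by (auto simp: max_def min_def)
    qed
    obtain c where c: "reach \<beta> (x / \<epsilon>, y / \<epsilon>) c" "\<epsilon> * c \<le> v + \<epsilon> * (\<bar>L\<bar> + 2 + \<beta>)"
    proof -
      have cone: "(2 * real (k_c \<beta>) + 1) * \<bar>b / \<epsilon>\<bar> \<le> \<bar>a / \<epsilon>\<bar>" "\<bar>b\<bar> \<le> \<bar>a\<bar>"
        if "(2 * real (k_c \<beta>) + 1) * \<bar>b\<bar> \<le> \<bar>a\<bar>" for a b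
      proof -
        show "(2 * real (k_c \<beta>) + 1) * \<bar>b / \<epsilon>\<bar> \<le> \<bar>a / \<epsilon>\<bar>"
          using divide_right_mono[OF that, of \<epsilon>] \<epsilon> by (simp add: abs_divide)
        have "1 * \<bar>b\<bar> \<le> (2 * real (k_c \<beta>) + 1) * \<bar>b\<bar>" by (intro mult_right_mono) auto
        then show "\<bar>b\<bar> \<le> \<bar>a\<bar>" using that by simp
      qed
      have scale: "\<epsilon> * c \<le> \<bar>a\<bar> + L * \<bar>b\<bar> + \<epsilon> * (\<bar>L\<bar> + 2 + \<beta>)"
        if "c \<le> \<bar>a / \<epsilon>\<bar> + L * \<bar>b / \<epsilon>\<bar> + (\<bar>L\<bar> + 2 + \<beta>)" for a b c
        using mult_left_mono[OF that, of \<epsilon>] \<epsilon> by (simp add: distrib_left abs_divide)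
      show thesis
        using assms(2)
      proof
        assume A: "(2 * real (k_c \<beta>) + 1) * \<bar>y\<bar> \<le> \<bar>x\<bar>"
        obtain c where "reach \<beta> (x / \<epsilon>, y / \<epsilon>) c" "c \<le> \<bar>x / \<epsilon>\<bar> + L * \<bar>y / \<epsilon>\<bar> + (\<bar>L\<bar> + 2 + \<beta>)"
          using reach_cone_abs[OF \<beta> cone(1)[OF A]] unfolding L_def by blast
        moreover have "v = \<bar>x\<bar> + L * \<bar>y\<bar>" using cone(2)[OF A] by (simp add: v_def)
        ultimately show thesis using that[of c] scale[of c x y] by simp
      next
        assume A: "(2 * real (k_c \<beta>) + 1) * \<bar>x\<bar> \<le> \<bar>y\<bar>"
        obtain c where "reach \<beta> (y / \<epsilon>, x / \<epsilon>) c" "c \<le> \<bar>y / \<epsilon>\<bar> + L * \<bar>x / \<epsilon>\<bar> + (\<bar>L\<bar> + 2 + \<beta>)"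
          using reach_cone_abs[OF \<beta> cone(1)[OF A]] unfolding L_def by blast
        moreover have "v = \<bar>y\<bar> + L * \<bar>x\<bar>" using cone(2)[OF A] by (simp add: v_def)
        ultimately show thesis using that[of c] reach_swap scale[of c y x] by simp
      qed
    qed
    obtain u where u: "abs_cont_on 0 1 u" "u 0 = (0, 0)" "u 1 = \<epsilon> *\<^sub>R (x / \<epsilon>, y / \<epsilon>)" "wlength \<beta> \<epsilon> u = \<epsilon> * c"
      by (rule reach_imp_curve[OF c(1) \<epsilon>])
    \<comment> \<open>This curve gives the upper bound and also shows that the set is nonempty, so
      that the infimum inherits the lower bound.\<close>
    then have mem: "\<epsilon> * c \<in> ?W" using \<epsilon> by (intro CollectI exI[of _ u]) auto
    have bdd: "bdd_below ?W" using lower by (rule bdd_belowI)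
    have "d_eps \<beta> \<epsilon> (x, y) \<le> \<epsilon> * c" unfolding d_eps_def by (rule cInf_lower[OF mem bdd])
    moreover have "v - \<epsilon> * \<bar>L\<bar> \<le> d_eps \<beta> \<epsilon> (x, y)"
      unfolding d_eps_def using mem lower by (intro cInf_greatest) auto
    moreover have "\<epsilon> * (\<bar>L\<bar> + 2 + \<beta>) = \<epsilon> * \<bar>L\<bar> + \<epsilon> * (2 + \<beta>)" "\<epsilon> * (2 + \<beta>) \<ge> 0" "\<epsilon> * \<bar>L\<bar> \<ge> 0"
      using \<epsilon> \<beta> by (simp_all add: distrib_left)
    ultimately show "\<bar>d_eps \<beta> \<epsilon> (x, y) - v\<bar> \<le> (\<bar>L\<bar> + 2 + \<beta>) * \<epsilon>"
      using c(2) by (simp only: abs_le_iff mult.commute[of _ \<epsilon>]) linarith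
  qed
  then show ?thesis unfolding v_def L_def lf_even[OF \<beta>] .
qed

end
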